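(* Let $\gamma>1$ and let $K$ be the Bernoulli constant, and consider the sonic configuration $(\Omega^\pm,\varphi^\pm,\Gamma_{\rm sonic})$ described in the context. Assume that the pseudo-sonic curve is connected. If the pseudo-velocity field $(U,V)$ is tangential to the pseudo-sonic curve and $\partial_{\mathbf n}c\neq0$ on $\Gamma_{\rm sonic}$, then the pseudo-sonic curve is strictly convex when viewed from the pseudo-supersonic domain $\Omega^-$.
   Context: Equation. Fix $\gamma>1$ and a constant $K$. In self-similar coordinates $(\xi,\eta)\in\mathbb{R}^2$, with $D=(\partial_\xi,\partial_\eta)$, self-similar potential flow is $\mathrm{div}(\rho D\varphi)+2\rho=0$ with $\rho=(K-\varphi-\frac12|D\varphi|^2)^{1/(\gamma-1)}$. The sonic speed $c$ is given by $c^2=(\gamma-1)(K-\varphi-\frac12|D\varphi|^2)$. The pseudo-velocity is $(U,V)=D\varphi$ and the velocity is $(u,v)=(U,V)+(\xi,\eta)$. Equivalently, $(c^2-U^2)u_\xi-UV(u_\eta+v_\xi)+(c^2-V^2)v_\eta=0$, $u_\eta=v_\xi$, and $\frac{c^2}{\gamma-1}+\frac{U^2+V^2}{2}+\varphi=K$. The flow is pseudo-supersonic where $|D\varphi|>c$, pseudo-subsonic where $|D\varphi|<c$, and a point is pseudo-sonic if $|D\varphi|=c$. Configuration. The set of all pseudo-sonic points is assumed to form a curve (the pseudo-sonic curve), and $\Gamma_{\rm sonic}$ denotes its relative interior. $\Omega^-$ and $\Omega^+$ are the pseudo-supersonic and pseudo-subsonic regions of a solution $\varphi$. $\varphi^-\in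 C^2(\overline{\Omega^-})$ is a pseudo-supersonic solution in $\Omega^-$, $\varphi^+\in C^2(\Omega^+\cup\Gamma_{\rm sonic})$ is a pseudo-subsonic solution in $\Omega^+$, and $\varphi^+=\varphi^-$, $D\varphi^+=D\varphi^-$ on $\Gamma_{\rm sonic}$. For each $Q\in\Gamma_{\rm sonic}$, one can choose suitable $(\xi,\eta)$-coordinates for which there is $r>0$ such that $\Gamma_{\rm sonic}\cap B_r(Q)=\{\eta=f(\xi)\}\cap B_r(Q)$ with $f\in C^{1,1}((l_1,l_2))$, $l_1<l_2$ real numbers, where $B_r(Q)$ is the ball of radius $r$ centered at $Q$. Notation. $\partial_{\mathbf n}=f'(\xi)\partial_\xi-\partial_\eta$ is the normal derivative along the pseudo-sonic curve; derivatives of $c$ at points of $\Gamma_{\rm sonic}$ are one-sided (e.g. taken from $\overline{\Omega^-}$). $(U,V)$ tangential to the pseudo-sonic curve means $f'U-V=0$ on $\Gamma_{\rm sonic}$. Convex when viewed from $\Omega^-$ means that for every $Q\in\Gamma_{\rm sonic}$ there exists $r>0$ such that $\Omega^-\cap B_r(Q)$ is convex; "strictly" has its usual sense. *)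

theory Defs
  imports "HOL-Analysis.Analysis"
begin

type_synonym plane = "real \<times> real"

subsection \<open>Differential calculus in the plane, up to the boundary\<close>

definition grad :: "(plane \<Rightarrow> real) \<Rightarrow> plane \<Rightarrow> plane" where
  "grad f x = (frechet_derivative f (at x) (1, 0), frechet_derivative f (at x) (0, 1))"

definition hess :: "(plane \<Rightarrow> real) \<Rightarrow> plane \<Rightarrow> plane \<times> plane" where
  "hess f x = (grad (\<lambda>y. fst (grad f y)) x, grad (\<lambda>y. snd (grad f y)) x)"

definition divergence :: "(plane \<Rightarrow> plane) \<Rightarrow> plane \<Rightarrow> real" where
  "divergence W x = fst (grad (\<lambda>y. fst (W y)) x) + snd (grad (\<lambda>y. snd (W y)) x)"

text \<open>The gradient of \<open>f\<close> taken from inside an open set \<open>\<Omega>\<close>: for \<open>f\<close> of class C1 up to a boundary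
  point \<open>x\<close> it is the one-sided gradient, and for \<open>x \<in> \<Omega>\<close> it is the ordinary gradient.\<close>

definition grad_from :: "plane set \<Rightarrow> (plane \<Rightarrow> real) \<Rightarrow> plane \<Rightarrow> plane" where
  "grad_from \<Omega> f x = Lim (at x within \<Omega>) (grad f)"

text \<open>\<open>f\<close> is of class C2 on \<open>A\<close>, where \<open>\<Omega>\<close> is open and \<open>\<Omega> \<subseteq> A \<subseteq> closure \<Omega>\<close>: it is twice
  differentiable in \<open>\<Omega>\<close>, and it and its first and second derivatives extend continuously to \<open>A\<close>.\<close>

definition C2_up_to :: "plane set \<Rightarrow> plane set \<Rightarrow> (plane \<Rightarrow> real) \<Rightarrow> bool" where
  "C2_up_to \<Omega> A f \<longleftrightarrow>
     (\<forall>x\<in>\<Omega>. f differentiable (at x) \<and> grad f differentiable (at x)) \<and>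
     continuous_on A f \<and>
     (\<exists>G. continuous_on A G \<and> (\<forall>x\<in>\<Omega>. G x = grad f x)) \<and>
     (\<exists>H. continuous_on A H \<and> (\<forall>x\<in>\<Omega>. H x = hess f x))"

definition C11_on :: "real set \<Rightarrow> (real \<Rightarrow> real) \<Rightarrow> bool" where
  "C11_on I f \<longleftrightarrow> (\<forall>t\<in>I. f differentiable (at t)) \<and> (\<exists>L. L-lipschitz_on I (deriv f))"

subsection \<open>Self-similar potential flow\<close>

text \<open>Density and sonic speed as functions of the values \<open>q\<close> of the potential and \<open>w\<close> of the
  pseudo-velocity.\<close>

definition density :: "real \<Rightarrow> real \<Rightarrow> real \<Rightarrow> plane \<Rightarrow> real" where
  "density \<gamma> K q w = (K - q - (norm w)\<^sup>2 / 2) powr (1 / (\<gamma> - 1))"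

definition sonic_speed :: "real \<Rightarrow> real \<Rightarrow> real \<Rightarrow> plane \<Rightarrow> real" where
  "sonic_speed \<gamma> K q w = sqrt ((\<gamma> - 1) * (K - q - (norm w)\<^sup>2 / 2))"

definition speed_field :: "real \<Rightarrow> real \<Rightarrow> plane set \<Rightarrow> (plane \<Rightarrow> real) \<Rightarrow> plane \<Rightarrow> real" where
  "speed_field \<gamma> K \<Omega> \<phi> x = sonic_speed \<gamma> K (\<phi> x) (grad_from \<Omega> \<phi> x)"

text \<open>Since \<open>powr\<close> and \<open>sqrt\<close> are total, the requirement that the base be positive
  (no vacuum) is stated separately.\<close>

definition potential_flow_solution :: "real \<Rightarrow> real \<Rightarrow> plane set \<Rightarrow> (plane \<Rightarrow> real) \<Rightarrow> bool" where
  "potential_flow_solution \<gamma> K \<Omega> \<phi> \<longleftrightarrow>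
     (\<forall>x\<in>\<Omega>. 0 < K - \<phi> x - (norm (grad \<phi> x))\<^sup>2 / 2 \<and>
        divergence (\<lambda>y. density \<gamma> K (\<phi> y) (grad \<phi> y) *\<^sub>R grad \<phi> y) x
          + 2 * density \<gamma> K (\<phi> x) (grad \<phi> x) = 0)"

text \<open>\<open>x\<close> is pseudo-sonic for the values of \<open>\<phi>\<close> and its gradient taken from \<open>\<Omega>\<close>; relational, so
  that nothing is claimed at points where these limits do not exist.\<close>

definition pseudo_sonic_from ::
  "real \<Rightarrow> real \<Rightarrow> plane set \<Rightarrow> (plane \<Rightarrow> real) \<Rightarrow> plane \<Rightarrow> bool" where
  "pseudo_sonic_from \<gamma> K \<Omega> \<phi> x \<longleftrightarrow> x \<in> closure \<Omega> \<and>
     (\<exists>q w. (\<phi> \<longlongrightarrow> q) (at x within \<Omega>) \<and> (grad \<phi> \<longlongrightarrow> w) (at x within \<Omega>) \<and>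
        norm w = sonic_speed \<gamma> K q w)"

text \<open>All pseudo-sonic points of the flow region \<open>\<Lambda>\<close>.  It need not be open, so endpoints of the
  pseudo-sonic curve may lie on its boundary.\<close>

definition pseudo_sonic_set ::
  "real \<Rightarrow> real \<Rightarrow> plane set \<Rightarrow> plane set \<Rightarrow> plane set \<Rightarrow> (plane \<Rightarrow> real) \<Rightarrow> (plane \<Rightarrow> real)
     \<Rightarrow> plane set" where
  "pseudo_sonic_set \<gamma> K \<Lambda> \<Omega>m \<Omega>p \<phi>m \<phi>p =
     {x \<in> \<Lambda>. pseudo_sonic_from \<gamma> K \<Omega>m \<phi>m x \<or> pseudo_sonic_from \<gamma> K \<Omega>p \<phi>p x}"

subsection \<open>Curves\<close>

text \<open>A curve is a one-dimensional topological manifold, possibly with endpoints; its relative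
  interior is what remains when the endpoints are removed.\<close>

definition is_curve :: "plane set \<Rightarrow> bool" where
  "is_curve S \<longleftrightarrow>
     (\<forall>x\<in>S. \<exists>N. openin (top_of_set S) N \<and> x \<in> N \<and>
        (N homeomorphic {0<..<1::real} \<or> N homeomorphic {0..<1::real}))"

definition curve_interior :: "plane set \<Rightarrow> plane set" where
  "curve_interior S =
     {x. \<exists>N. openin (top_of_set S) N \<and> x \<in> N \<and> N homeomorphic {0<..<1::real}}"

text \<open>Near \<open>Q\<close> the curve is the graph of a C11 function \<open>f\<close> in suitable coordinates, given by an
  orthogonal map \<open>T\<close>: the point with new coordinates \<open>(\<xi>, \<eta>)\<close> is \<open>T (\<xi>, \<eta>)\<close>.  A translation of the
  origin can be absorbed into \<open>f\<close>.\<close>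

definition graph_chart ::
  "plane set \<Rightarrow> plane \<Rightarrow> (plane \<Rightarrow> plane) \<Rightarrow> real \<Rightarrow> real \<Rightarrow> real \<Rightarrow> (real \<Rightarrow> real) \<Rightarrow> bool" where
  "graph_chart \<Gamma> Q T r l1 l2 f \<longleftrightarrow>
     orthogonal_transformation T \<and> 0 < r \<and> l1 < l2 \<and> C11_on {l1<..<l2} f \<and>
     \<Gamma> \<inter> ball Q r = T ` {(\<xi>, f \<xi>) |\<xi>. l1 < \<xi> \<and> \<xi> < l2} \<inter> ball Q r"

text \<open>\<open>f' W\<^sub>1 - W\<^sub>2\<close> at \<open>Q\<close>, where \<open>W\<^sub>1, W\<^sub>2\<close> are the components of the vector \<open>W\<close> in the
  coordinates \<open>T\<close>.  For \<open>W = (U, V)\<close> it vanishes iff \<open>W\<close> is tangential.  As \<open>T\<close> is orthogonal,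
  gradients transform like vectors, so for \<open>W = Dc\<close> this is the normal derivative
  \<open>f' \<partial>\<^sub>\<xi> c - \<partial>\<^sub>\<eta> c\<close>.\<close>

definition normal_part :: "(plane \<Rightarrow> plane) \<Rightarrow> (real \<Rightarrow> real) \<Rightarrow> plane \<Rightarrow> plane \<Rightarrow> real" where
  "normal_part T f Q W = deriv f (fst (inv T Q)) * fst (inv T W) - snd (inv T W)"

text \<open>The vanishing of \<open>normal_part\<close> does not depend on the choice of chart at \<open>Q\<close>.\<close>

definition tangential_along :: "plane set \<Rightarrow> (plane \<Rightarrow> plane) \<Rightarrow> bool" where
  "tangential_along \<Gamma> W \<longleftrightarrow>
     (\<forall>Q\<in>\<Gamma>. \<forall>T r l1 l2 f. graph_chart \<Gamma> Q T r l1 l2 f \<longrightarrow> normal_part T f Q (W Q) = 0)"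

definition normal_derivative_nonzero ::
  "plane set \<Rightarrow> plane set \<Rightarrow> (plane \<Rightarrow> real) \<Rightarrow> bool" where
  "normal_derivative_nonzero \<Gamma> \<Omega> c \<longleftrightarrow>
     (\<forall>Q\<in>\<Gamma>. \<forall>T r l1 l2 f. graph_chart \<Gamma> Q T r l1 l2 f \<longrightarrow>
        normal_part T f Q (grad_from \<Omega> c Q) \<noteq> 0)"

text \<open>Strictness: the interior of every chord of the curve lies in \<open>\<Omega>\<close>.\<close>

definition strictly_convex_viewed_from :: "plane set \<Rightarrow> plane set \<Rightarrow> bool" where
  "strictly_convex_viewed_from \<Omega> \<Gamma> \<longleftrightarrow>
     (\<forall>Q\<in>\<Gamma>. \<exists>r>0. convex (\<Omega> \<inter> ball Q r) \<and>
        (\<forall>x\<in>\<Gamma> \<inter> ball Q r. \<forall>y\<in>\<Gamma> \<inter> ball Q r. x \<noteq> y \<longrightarrow> open_segment x y \<subseteq> \<Omega>))"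

subsection \<open>The sonic configuration\<close>

text \<open>\<open>\<Omega>m, \<phi>m\<close> and \<open>\<Omega>p, \<phi>p\<close> are the pseudo-supersonic and pseudo-subsonic regions and solutions,
  \<open>S\<close> is the pseudo-sonic curve and \<open>\<Gamma>\<close> its relative interior.\<close>

locale sonic_configuration =
  fixes \<gamma> K :: real
    and \<Lambda> \<Omega>m \<Omega>p :: "plane set"
    and \<phi>m \<phi>p :: "plane \<Rightarrow> real"
    and S \<Gamma> :: "plane set"
  assumes open_minus: "open \<Omega>m" and open_plus: "open \<Omega>p"
    and disjoint: "\<Omega>m \<inter> \<Omega>p = {}"
    and regions: "\<Omega>m \<union> \<Omega>p \<subseteq> \<Lambda>" "interior \<Lambda> \<subseteq> \<Omega>m \<union> \<Omega>p \<union> S"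
    and S_eq: "S = pseudo_sonic_set \<gamma> K \<Lambda> \<Omega>m \<Omega>p \<phi>m \<phi>p"
    and curve: "is_curve S"
    and \<Gamma>_eq: "\<Gamma> = curve_interior S"
    and interface: "\<Gamma> \<subseteq> interior \<Lambda>" "\<Gamma> \<subseteq> closure \<Omega>m" "\<Gamma> \<subseteq> closure \<Omega>p"
    and regular_minus: "C2_up_to \<Omega>m (closure \<Omega>m) \<phi>m"
    and regular_plus: "C2_up_to \<Omega>p (\<Omega>p \<union> \<Gamma>) \<phi>p"
    and solution_minus: "potential_flow_solution \<gamma> K \<Omega>m \<phi>m"
    and solution_plus: "potential_flow_solution \<gamma> K \<Omega>p \<phi>p"
    and supersonic: "\<forall>x\<in>\<Omega>m. norm (grad \<phi>m x) > sonic_speed \<gamma> K (\<phi>m x) (grad \<phi>m x)"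
    and subsonic: "\<forall>x\<in>\<Omega>p. norm (grad \<phi>p x) < sonic_speed \<gamma> K (\<phi>p x) (grad \<phi>p x)"
    and matching: "\<forall>x\<in>\<Gamma>. \<phi>p x = \<phi>m x \<and> grad_from \<Omega>p \<phi>p x = grad_from \<Omega>m \<phi>m x"
    and no_vacuum: "\<forall>x\<in>\<Gamma>. 0 < speed_field \<gamma> K \<Omega>m \<phi>m x"
    and charts: "\<forall>Q\<in>\<Gamma>. \<exists>T r l1 l2 f. graph_chart \<Gamma> Q T r l1 l2 f"

end

theory Submission
  imports Defs
begin

text \<open>The sign of \<open>g = |D\<phi>|\<^sup>2 - c\<^sup>2\<close> determines the sign of the curvature.
  Let \<open>\<eta> = f(\<xi>)\<close> be the curve, with \<open>\<Omega>m\<close> above it after a reflection,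
  let \<open>m = f'\<close> and \<open>n = (-m, 1)\<close>, and let \<open>D\<phi> = U (1, m)\<close> be tangential.  On the curve \<open>g = 0\<close>, while
  \<open>g > 0\<close> above it, so \<open>\<partial>\<^sub>n g \<ge> 0\<close>.  By Bernoulli's law and \<open>D\<phi> \<bullet> n = 0\<close>, both
  \<open>\<partial>\<^sub>n g = (\<gamma> + 1) D\<^sup>2\<phi>(D\<phi>, n)\<close> and \<open>2 c \<partial>\<^sub>n c = -(\<gamma> - 1) D\<^sup>2\<phi>(D\<phi>, n)\<close>, hence
  \<open>D\<^sup>2\<phi>(D\<phi>, n) > 0\<close>.  Differentiating \<open>f' = V / U\<close> along the curve gives
  \<open>f'' = D\<^sup>2\<phi>(D\<phi>, n) / U\<^sup>2 > 0\<close>.\<close>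

subsection \<open>Gradients and Hessians up to the boundary\<close>

text \<open>All formulas of the overview live on the curve, where \<open>\<phi>m\<close> is
  controlled from one side only and \<open>f''\<close> need not exist, \<open>f\<close> being merely
  C11. Values on the curve are therefore limits from \<open>\<Omega>m\<close>: \<open>G\<close> and
  \<open>H\<close> are the continuous extensions of gradient and Hessian, the bilinear form of the
  Hessian is \<open>hess_map (H x) v \<bullet> w\<close>, and the sign of the curvature is expressed
  as strict monotonicity of \<open>f'\<close>, which is all that convexity needs. The normal
  derivative of \<open>|D\<phi>|\<^sup>2\<close> produces the Hessian applied to \<open>n\<close>
  and paired with \<open>D\<phi>\<close>, the slope of \<open>V / U\<close> produces it applied to
  \<open>D\<phi>\<close> and paired with \<open>n\<close>; to compare them, symmetry of the extended
  Hessian is established first. That \<open>\<Omega>m\<close> lies on exactly one side of the curve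
  is a topological fact to be derived: near \<open>Q\<close> the complement of the graph consists of
  two connected halves, each inside one region, and \<open>Q\<close> is in the closure of both
  regions.\<close>

definition hess_map :: "plane \<times> plane \<Rightarrow> plane \<Rightarrow> plane" where
  "hess_map M v = (fst M \<bullet> v, snd M \<bullet> v)"

lemma continuous_on_hess_map [continuous_intros]:
  assumes "continuous_on A M" "continuous_on A v"
  shows "continuous_on A (\<lambda>x. hess_map (M x) (v x))"
  unfolding hess_map_def by (intro continuous_intros assms)

lemma tendsto_hess_map [tendsto_intros]:
  assumes "(M \<longlongrightarrow> m) F" "(v \<longlongrightarrow> w) F"
  shows "((\<lambda>x. hess_map (M x) (v x)) \<longlongrightarrow> hess_map m w) F"
  unfolding hess_map_def by (intro tendsto_intros assms)

lemma hess_map_scaleR: "hess_map M (a *\<^sub>R v) = a *\<^sub>R hess_map M v"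
  by (simp add: hess_map_def)

lemma linear_plane_eq_inner:
  fixes L :: "plane \<Rightarrow> real"
  assumes "linear L"
  shows "L v = (L (1, 0), L (0, 1)) \<bullet> v"
proof -
  have "v = fst v *\<^sub>R (1, 0) + snd v *\<^sub>R (0, 1)"
    by (simp add: prod_eq_iff)
  then have "L v = L (fst v *\<^sub>R (1, 0) + snd v *\<^sub>R (0, 1))"
    by (rule arg_cong)
  also have "\<dots> = (L (1, 0), L (0, 1)) \<bullet> v"
    by (simp add: linear_add[OF assms] linear_scale[OF assms] inner_prod_def mult.commute
        del: scaleR_Pair add_Pair)
  finally show ?thesis .
qed

lemma has_derivative_grad:
  assumes "f differentiable (at x)"
  shows "(f has_derivative (\<lambda>v. grad f x \<bullet> v)) (at x)"
proof -
  have D: "(f has_derivative frechet_derivative f (at x)) (at x)"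
    using assms frechet_derivative_works by blast
  have "frechet_derivative f (at x) = (\<lambda>v. grad f x \<bullet> v)"
    using linear_plane_eq_inner[OF has_derivative_linear[OF D]] unfolding grad_def by blast
  with D show ?thesis by simp
qed

lemma grad_eqI:
  assumes "(f has_derivative (\<lambda>v. g \<bullet> v)) (at x)"
  shows "grad f x = g"
  unfolding grad_def frechet_derivative_at[OF assms, symmetric] by (simp add: inner_prod_def)

lemma has_derivative_hess:
  assumes "grad f differentiable (at x)"
  shows "(grad f has_derivative hess_map (hess f x)) (at x)"
proof -
  have "(\<lambda>y. fst (grad f y)) differentiable (at x)" "(\<lambda>y. snd (grad f y)) differentiable (at x)"
    using assms unfolding differentiable_def by (blast intro: has_derivative_fst has_derivative_snd)+
  then have "((\<lambda>y. (fst (grad f y), snd (grad f y))) has_derivative hess_map (hess f x)) (at x)"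
    unfolding hess_map_def hess_def fst_conv snd_conv
    by (intro has_derivative_Pair has_derivative_grad)
  then show ?thesis by simp
qed

lemma DERIV_along_line:
  fixes f :: "plane \<Rightarrow> real"
  assumes "(f has_derivative (\<lambda>v. g \<bullet> v)) (at (x + s *\<^sub>R v))"
  shows "((\<lambda>t. f (x + t *\<^sub>R v)) has_real_derivative g \<bullet> v) (at s)"
proof -
  have "((\<lambda>t. x + t *\<^sub>R v) has_derivative (\<lambda>t. t *\<^sub>R v)) (at s)"
    by (auto intro!: derivative_eq_intros)
  from has_derivative_compose[OF this, of f "\<lambda>v. g \<bullet> v"] assms
  show ?thesis
    by (simp add: has_field_derivative_def mult.commute[of _ "g \<bullet> v"] mult_commute_abs)
qed

section \<open>Equality of the mixed second derivatives\<close>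

text \<open>The mean value theorem is applied twice, to the increment in direction \<open>w\<close>
  as a function along \<open>v\<close>, then to \<open>G \<bullet> v\<close> along \<open>w\<close>.
  The left side is symmetric in \<open>v\<close> and \<open>w\<close> while the right side is not,
  which is the source of the symmetry of the Hessian.\<close>

lemma second_difference_eq:
  fixes f :: "plane \<Rightarrow> real" and x v w :: plane
  assumes "0 < h" and ball: "ball x d \<subseteq> A" and hd: "h * (norm v + norm w) < d"
    and D1: "\<And>y. y \<in> A \<Longrightarrow> (f has_derivative (\<lambda>v. G y \<bullet> v)) (at y)"
    and D2: "\<And>y. y \<in> A \<Longrightarrow> (G has_derivative hess_map (H y)) (at y)"
  shows "\<exists>y\<in>ball x d. f (x + h *\<^sub>R v + h *\<^sub>R w) - f (x + h *\<^sub>R v) - f (x + h *\<^sub>R w) + f x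
            = h * h * (hess_map (H y) w \<bullet> v)"
proof -
  have near: "x + s *\<^sub>R v + t *\<^sub>R w \<in> ball x d" if "0 \<le> s" "s \<le> h" "0 \<le> t" "t \<le> h" for s t
  proof -
    have "norm (s *\<^sub>R v + t *\<^sub>R w) \<le> s * norm v + t * norm w"
      using norm_triangle_ineq[of "s *\<^sub>R v" "t *\<^sub>R w"] that by simp
    also have "\<dots> \<le> h * norm v + h * norm w"
      using that by (intro add_mono mult_right_mono) auto
    also have "\<dots> < d"
      using hd by (simp add: algebra_simps)
    finally have "norm (s *\<^sub>R v + t *\<^sub>R w) < d" .
    moreover have "dist (x + s *\<^sub>R v + t *\<^sub>R w) x = norm (s *\<^sub>R v + t *\<^sub>R w)"
      by (simp add: dist_norm add.assoc)
    ultimately show ?thesis by (simp add: dist_commute)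
  qed
  define g where "g s = f (x + h *\<^sub>R w + s *\<^sub>R v) - f (x + s *\<^sub>R v)" for s
  have "\<exists>z>0. z < h \<and> g h - g 0 = (h - 0) * (G (x + h *\<^sub>R w + z *\<^sub>R v) \<bullet> v - G (x + z *\<^sub>R v) \<bullet> v)"
    unfolding g_def
  proof (rule MVT2[OF \<open>0 < h\<close>])
    fix s assume s: "0 \<le> s" "s \<le> h"
    show "((\<lambda>s. f (x + h *\<^sub>R w + s *\<^sub>R v) - f (x + s *\<^sub>R v)) has_real_derivative
       G (x + h *\<^sub>R w + s *\<^sub>R v) \<bullet> v - G (x + s *\<^sub>R v) \<bullet> v) (at s)"
      using near[OF s, of h] near[OF s, of 0] \<open>0 < h\<close> ball
      by (intro DERIV_diff DERIV_along_line D1) (auto simp: algebra_simps)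
  qed
  then obtain s where s: "0 < s" "s < h"
    and gs: "g h - g 0 = h * (G (x + h *\<^sub>R w + s *\<^sub>R v) \<bullet> v - G (x + s *\<^sub>R v) \<bullet> v)"
    by auto
  have "\<exists>z>0. z < h \<and> G (x + s *\<^sub>R v + h *\<^sub>R w) \<bullet> v - G (x + s *\<^sub>R v + 0 *\<^sub>R w) \<bullet> v
      = (h - 0) * (hess_map (H (x + s *\<^sub>R v + z *\<^sub>R w)) w \<bullet> v)"
  proof (rule MVT2[OF \<open>0 < h\<close>])
    fix t assume t: "0 \<le> t" "t \<le> h"
    have A: "x + s *\<^sub>R v + t *\<^sub>R w \<in> A"
      using near[of s t] s t ball by auto
    have "((\<lambda>y. G y \<bullet> v) has_derivative (\<lambda>u. hess_map (H (x + s *\<^sub>R v + t *\<^sub>R w)) u \<bullet> v))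
        (at (x + s *\<^sub>R v + t *\<^sub>R w))"
      by (intro has_derivative_inner_left D2 A)
    then have "((\<lambda>y. G y \<bullet> v) has_derivative
        (\<lambda>u. (fst v *\<^sub>R fst (H (x + s *\<^sub>R v + t *\<^sub>R w)) + snd v *\<^sub>R snd (H (x + s *\<^sub>R v + t *\<^sub>R w))) \<bullet> u))
        (at (x + s *\<^sub>R v + t *\<^sub>R w))"
      by (simp add: hess_map_def inner_prod_def algebra_simps)
    from DERIV_along_line[OF this]
    show "((\<lambda>t. G (x + s *\<^sub>R v + t *\<^sub>R w) \<bullet> v) has_real_derivative
        hess_map (H (x + s *\<^sub>R v + t *\<^sub>R w)) w \<bullet> v) (at t)"
      by (simp add: hess_map_def inner_prod_def algebra_simps)
  qed
  then obtain t where t: "0 < t" "t < h"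
    and Gt: "G (x + s *\<^sub>R v + h *\<^sub>R w) \<bullet> v - G (x + s *\<^sub>R v) \<bullet> v
      = h * (hess_map (H (x + s *\<^sub>R v + t *\<^sub>R w)) w \<bullet> v)"
    by auto
  have "x + h *\<^sub>R w + s *\<^sub>R v = x + s *\<^sub>R v + h *\<^sub>R w" "x + h *\<^sub>R w + h *\<^sub>R v = x + h *\<^sub>R v + h *\<^sub>R w"
    by (simp_all add: algebra_simps)
  with gs Gt have "f (x + h *\<^sub>R v + h *\<^sub>R w) - f (x + h *\<^sub>R v) - f (x + h *\<^sub>R w) + f x
      = h * h * (hess_map (H (x + s *\<^sub>R v + t *\<^sub>R w)) w \<bullet> v)"
    by (simp add: g_def)
  moreover have "x + s *\<^sub>R v + t *\<^sub>R w \<in> ball x d"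
    using near s t by simp
  ultimately show ?thesis by blast
qed

text \<open>Exchanging \<open>v\<close> and \<open>w\<close> leaves the second difference unchanged,
  so the two mixed forms take a common value at two points near \<open>x\<close>; continuity of
  \<open>H\<close> brings both points to \<open>x\<close>.\<close>

lemma hess_map_symmetric:
  fixes f :: "plane \<Rightarrow> real"
  assumes "open A" "x \<in> A" "continuous_on A H"
    and D1: "\<And>y. y \<in> A \<Longrightarrow> (f has_derivative (\<lambda>v. G y \<bullet> v)) (at y)"
    and D2: "\<And>y. y \<in> A \<Longrightarrow> (G has_derivative hess_map (H y)) (at y)"
  shows "hess_map (H x) v \<bullet> w = hess_map (H x) w \<bullet> v"
proof (rule ccontr)
  assume ne: "\<not> ?thesis"
  \<comment> \<open>Half the gap: two numbers closer than \<open>e\<close> to the two values cannot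
    coincide.\<close>
  define e where "e = \<bar>hess_map (H x) v \<bullet> w - hess_map (H x) w \<bullet> v\<bar> / 2"
  have e: "e > 0" using ne by (simp add: e_def)
  have "continuous_on A (\<lambda>y. hess_map (H y) v \<bullet> w)" "continuous_on A (\<lambda>y. hess_map (H y) w \<bullet> v)"
    by (intro continuous_intros assms)+
  then have lim: "((\<lambda>y. hess_map (H y) v \<bullet> w) \<longlongrightarrow> hess_map (H x) v \<bullet> w) (nhds x)"
    "((\<lambda>y. hess_map (H y) w \<bullet> v) \<longlongrightarrow> hess_map (H x) w \<bullet> v) (nhds x)"
    using assms(1,2) by (auto simp: continuous_on_eq_continuous_at isCont_def tendsto_nhds_iff)
  have "\<forall>\<^sub>F y in nhds x. y \<in> A \<and> dist (hess_map (H y) v \<bullet> w) (hess_map (H x) v \<bullet> w) < e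
      \<and> dist (hess_map (H y) w \<bullet> v) (hess_map (H x) w \<bullet> v) < e"
    using tendstoD[OF lim(1) e] tendstoD[OF lim(2) e] eventually_nhds_in_open[OF assms(1,2)]
    by eventually_elim simp
  then obtain d where d: "d > 0" and near: "\<And>y. y \<in> ball x d \<Longrightarrow>
      y \<in> A \<and> dist (hess_map (H y) v \<bullet> w) (hess_map (H x) v \<bullet> w) < e
      \<and> dist (hess_map (H y) w \<bullet> v) (hess_map (H x) w \<bullet> v) < e"
    unfolding eventually_nhds_metric by (auto simp: dist_commute)
  \<comment> \<open>The summand 1 covers \<open>v = w = 0\<close> and gives
    \<open>h * (norm v + norm w) = d - h < d\<close>, as \<open>second_difference_eq\<close>
    requires.\<close>
  define h where "h = d / (norm v + norm w + 1)"
  have pos: "0 < norm v + norm w + 1"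
    by (simp add: add_nonneg_pos)
  then have h: "0 < h"
    using d by (simp add: h_def)
  have "h * (norm v + norm w) = d - h"
    using pos by (simp add: h_def field_simps)
  then have hd: "h * (norm v + norm w) < d"
    using h by simp
  have sub: "ball x d \<subseteq> A" using near by blast
  have hd': "h * (norm w + norm v) < d" using hd by (simp add: add.commute)
  obtain y where y: "y \<in> ball x d"
    "f (x + h *\<^sub>R v + h *\<^sub>R w) - f (x + h *\<^sub>R v) - f (x + h *\<^sub>R w) + f x = h * h * (hess_map (H y) w \<bullet> v)"
    using second_difference_eq[OF h sub hd D1 D2] by blast
  obtain z where z: "z \<in> ball x d"
    "f (x + h *\<^sub>R w + h *\<^sub>R v) - f (x + h *\<^sub>R w) - f (x + h *\<^sub>R v) + f x = h * h * (hess_map (H z) v \<bullet> w)"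
    using second_difference_eq[OF h sub hd' D1 D2] by blast
  have "x + h *\<^sub>R w + h *\<^sub>R v = x + h *\<^sub>R v + h *\<^sub>R w"
    by (simp add: algebra_simps)
  from y(2) z(2)[unfolded this] have "h * h * (hess_map (H y) w \<bullet> v) = h * h * (hess_map (H z) v \<bullet> w)"
    by linarith
  then have "hess_map (H y) w \<bullet> v = hess_map (H z) v \<bullet> w"
    using h by simp
  then show False
    using near[OF y(1)] near[OF z(1)] unfolding dist_real_def e_def by argo
qed

section \<open>One-sided calculus with extended gradient and Hessian\<close>

text \<open>\<open>C2_up_to\<close> provides the extensions only existentially; naming them allows
  formulas at boundary points. It is used with \<open>A = closure \<Omega>m\<close> and with
  \<open>A = \<Omega>p \<union> \<Gamma>\<close>.\<close>

locale C2_extension =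
  fixes \<Omega> A :: "plane set" and f :: "plane \<Rightarrow> real" and G :: "plane \<Rightarrow> plane"
    and H :: "plane \<Rightarrow> plane \<times> plane"
  assumes open_domain: "open \<Omega>" and domain_subset: "\<Omega> \<subseteq> A" and subset_closure: "A \<subseteq> closure \<Omega>"
    and cont: "continuous_on A f" and cont_G: "continuous_on A G" and cont_H: "continuous_on A H"
    and deriv: "x \<in> \<Omega> \<Longrightarrow> (f has_derivative (\<lambda>v. G x \<bullet> v)) (at x)"
    and deriv_G: "x \<in> \<Omega> \<Longrightarrow> (G has_derivative hess_map (H x)) (at x)"
begin

lemma grad_eq: "x \<in> \<Omega> \<Longrightarrow> grad f x = G x"
  by (rule grad_eqI[OF deriv])

text \<open>An open set has no isolated points, so limits from \<open>\<Omega>\<close> are unique at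
  every point of \<open>A\<close>. This makes the \<open>Lim\<close> in \<open>grad_from\<close>
  meaningful.\<close>

lemma at_within_domain: "x \<in> A \<Longrightarrow> at x within \<Omega> \<noteq> bot"
proof -
  assume "x \<in> A"
  have "x islimpt \<Omega>"
  proof (cases "x \<in> \<Omega>")
    case True
    then show ?thesis using interior_limit_point interior_open[OF open_domain] by metis
  next
    case False
    then show ?thesis using \<open>x \<in> A\<close> subset_closure by (auto simp: closure_def)
  qed
  then show ?thesis by (simp add: trivial_limit_within)
qed

lemma tendsto_within_domain:
  assumes "continuous_on A h" "x \<in> A"
  shows "(h \<longlongrightarrow> h x) (at x within \<Omega>)"
  using assms domain_subset continuous_on_def tendsto_within_subset by blast

lemma tendsto_grad: "x \<in> A \<Longrightarrow> (grad f \<longlongrightarrow> G x) (at x within \<Omega>)"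
  by (rule Lim_transform_eventually[OF tendsto_within_domain[OF cont_G]])
    (simp_all add: eventually_at_filter grad_eq)

lemma grad_from_eq: "x \<in> A \<Longrightarrow> grad_from \<Omega> f x = G x"
  unfolding grad_from_def by (intro tendsto_Lim at_within_domain tendsto_grad)

lemma symmetric:
  assumes "x \<in> A"
  shows "hess_map (H x) v \<bullet> w = hess_map (H x) w \<bullet> v"
proof (rule tendsto_unique[OF at_within_domain[OF assms]])
  have H: "(H \<longlongrightarrow> H x) (at x within \<Omega>)"
    by (rule tendsto_within_domain[OF cont_H assms])
  then show "((\<lambda>y. hess_map (H y) v \<bullet> w) \<longlongrightarrow> hess_map (H x) v \<bullet> w) (at x within \<Omega>)"
    by (intro tendsto_intros)
  have "((\<lambda>y. hess_map (H y) w \<bullet> v) \<longlongrightarrow> hess_map (H x) w \<bullet> v) (at x within \<Omega>)"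
    by (intro tendsto_intros H)
  moreover have "hess_map (H y) w \<bullet> v = hess_map (H y) v \<bullet> w" if "y \<in> \<Omega>" for y
    using hess_map_symmetric[OF open_domain that continuous_on_subset[OF cont_H domain_subset]
        deriv deriv_G] .
  ultimately show "((\<lambda>y. hess_map (H y) v \<bullet> w) \<longlongrightarrow> hess_map (H x) w \<bullet> v) (at x within \<Omega>)"
    by (elim Lim_transform_eventually) (simp add: eventually_at_filter)
qed

text \<open>On \<open>A\<close> both limits exist and are unique, so the existential values are
  forced to be \<open>f x\<close> and \<open>G x\<close>.\<close>

lemma pseudo_sonic_fromD:
  assumes "pseudo_sonic_from \<gamma> K \<Omega> f x" "x \<in> A"
  shows "norm (G x) = sonic_speed \<gamma> K (f x) (G x)"
proof -
  from assms(1) obtain q w where "(f \<longlongrightarrow> q) (at x within \<Omega>)" "(grad f \<longlongrightarrow> w) (at x within \<Omega>)"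
    "norm w = sonic_speed \<gamma> K q w"
    unfolding pseudo_sonic_from_def by blast
  moreover from this have "q = f x" "w = G x"
    using tendsto_unique[OF at_within_domain[OF assms(2)]]
      tendsto_within_domain[OF cont assms(2)] tendsto_grad[OF assms(2)] by blast+
  ultimately show ?thesis by simp
qed

lemma speed_field_eq: "x \<in> A \<Longrightarrow> speed_field \<gamma> K \<Omega> f x = sonic_speed \<gamma> K (f x) (G x)"
  by (simp add: speed_field_def grad_from_eq)

text \<open>Differentiating \<open>c\<^sup>2 = (\<gamma> - 1) (K - f - |G|\<^sup>2 / 2)\<close>
  gives \<open>2 c Dc = - (\<gamma> - 1) (G + H G)\<close>; symmetry of the Hessian turns
  \<open>H v \<bullet> G\<close> into \<open>H G \<bullet> v\<close>.\<close>

lemma grad_speed_field: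
  assumes "x \<in> \<Omega>" "0 < (\<gamma> - 1) * (K - f x - (norm (G x))\<^sup>2 / 2)"
  shows "grad (speed_field \<gamma> K \<Omega> f) x
    = - ((\<gamma> - 1) / (2 * sonic_speed \<gamma> K (f x) (G x))) *\<^sub>R (G x + hess_map (H x) (G x))"
proof (rule grad_eqI)
  let ?b = "\<lambda>x. (\<gamma> - 1) * (K - f x - (G x \<bullet> G x) / 2)"
  have "(?b has_derivative (\<lambda>v. (\<gamma> - 1) *
      (0 - G x \<bullet> v - (G x \<bullet> hess_map (H x) v + hess_map (H x) v \<bullet> G x) / 2))) (at x)"
    using deriv[OF assms(1)] deriv_G[OF assms(1)]
    by (auto intro!: derivative_eq_intros simp: field_simps)
  then have b: "(?b has_derivative (\<lambda>v. - (\<gamma> - 1) * ((G x + hess_map (H x) (G x)) \<bullet> v))) (at x)"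
  proof (rule has_derivative_eq_rhs, intro ext)
    fix v
    have sym: "hess_map (H x) v \<bullet> G x = hess_map (H x) (G x) \<bullet> v"
      using symmetric assms(1) domain_subset by blast
    show "(\<gamma> - 1) * (0 - G x \<bullet> v - (G x \<bullet> hess_map (H x) v + hess_map (H x) v \<bullet> G x) / 2)
        = - (\<gamma> - 1) * ((G x + hess_map (H x) (G x)) \<bullet> v)"
      unfolding inner_commute[of "G x" "hess_map (H x) v"] sym inner_add_left
      by (simp add: algebra_simps)
  qed
  have pos: "0 < ?b x"
    using assms(2) by (simp add: power2_norm_eq_inner)
  have "((\<lambda>x. sqrt (?b x)) has_derivative (\<lambda>v. (- (\<gamma> - 1) * ((G x + hess_map (H x) (G x)) \<bullet> v))
      * (inverse (sqrt (?b x)) / 2))) (at x)"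
    using has_derivative_compose[OF b DERIV_real_sqrt[OF pos, unfolded has_field_derivative_def]]
    by (simp add: mult.commute)
  then have "((\<lambda>x. sqrt (?b x)) has_derivative (\<lambda>v. (- ((\<gamma> - 1) / (2 * sonic_speed \<gamma> K (f x) (G x))) *\<^sub>R
      (G x + hess_map (H x) (G x))) \<bullet> v)) (at x)"
  proof (rule has_derivative_eq_rhs, intro ext)
    have eq: "- (\<gamma> - 1) * p * (inverse s / 2) = - ((\<gamma> - 1) / (2 * s)) * p" for p s :: real
      by (simp add: field_split_simps)
    show "- (\<gamma> - 1) * ((G x + hess_map (H x) (G x)) \<bullet> v) * (inverse (sqrt (?b x)) / 2)
        = (- ((\<gamma> - 1) / (2 * sonic_speed \<gamma> K (f x) (G x))) *\<^sub>R (G x + hess_map (H x) (G x))) \<bullet> v" for v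
      unfolding eq inner_scaleR_left sonic_speed_def power2_norm_eq_inner ..
  qed
  then show "(speed_field \<gamma> K \<Omega> f has_derivative (\<lambda>v. (- ((\<gamma> - 1) / (2 * sonic_speed \<gamma> K (f x) (G x))) *\<^sub>R
      (G x + hess_map (H x) (G x))) \<bullet> v)) (at x)"
    by (rule has_derivative_transform_within_open[OF _ open_domain assms(1)])
      (use domain_subset in \<open>auto simp: speed_field_eq sonic_speed_def power2_norm_eq_inner\<close>)
qed

text \<open>The formula at interior points is continuous up to \<open>x\<close>, since its
  denominator tends to a positive multiple of the sonic speed at \<open>x\<close>.\<close>

lemma grad_from_speed_field:
  assumes "x \<in> A" "0 < speed_field \<gamma> K \<Omega> f x"
    and pos: "\<And>y. y \<in> \<Omega> \<Longrightarrow> 0 < (\<gamma> - 1) * (K - f y - (norm (G y))\<^sup>2 / 2)"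
  shows "grad_from \<Omega> (speed_field \<gamma> K \<Omega> f) x
    = - ((\<gamma> - 1) / (2 * sonic_speed \<gamma> K (f x) (G x))) *\<^sub>R (G x + hess_map (H x) (G x))"
  unfolding grad_from_def
proof (rule tendsto_Lim[OF at_within_domain[OF assms(1)]])
  have lims: "(f \<longlongrightarrow> f x) (at x within \<Omega>)" "(G \<longlongrightarrow> G x) (at x within \<Omega>)" "(H \<longlongrightarrow> H x) (at x within \<Omega>)"
    by (intro tendsto_within_domain cont cont_G cont_H assms(1))+
  have nz: "2 * sqrt ((\<gamma> - 1) * (K - f x - (norm (G x))\<^sup>2 / 2)) \<noteq> 0"
    using assms(2) unfolding speed_field_eq[OF assms(1)] sonic_speed_def by linarith
  have "((\<lambda>y. - ((\<gamma> - 1) / (2 * sonic_speed \<gamma> K (f y) (G y))) *\<^sub>R (G y + hess_map (H y) (G y)))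
      \<longlongrightarrow> - ((\<gamma> - 1) / (2 * sonic_speed \<gamma> K (f x) (G x))) *\<^sub>R (G x + hess_map (H x) (G x)))
      (at x within \<Omega>)"
    unfolding sonic_speed_def by (intro tendsto_intros lims) (fact nz | simp)+
  then show "(grad (speed_field \<gamma> K \<Omega> f)
      \<longlongrightarrow> - ((\<gamma> - 1) / (2 * sonic_speed \<gamma> K (f x) (G x))) *\<^sub>R (G x + hess_map (H x) (G x)))
      (at x within \<Omega>)"
    by (rule Lim_transform_eventually) (simp add: eventually_at_filter grad_speed_field pos)
qed

end

lemma C2_up_to_extension:
  assumes "open \<Omega>" "\<Omega> \<subseteq> A" "A \<subseteq> closure \<Omega>" "C2_up_to \<Omega> A f"
  obtains G H where "C2_extension \<Omega> A f G H"
proof -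
  from assms(4) obtain G H where GH: "continuous_on A f" "continuous_on A G" "continuous_on A H"
    "\<And>x. x \<in> \<Omega> \<Longrightarrow> G x = grad f x" "\<And>x. x \<in> \<Omega> \<Longrightarrow> H x = hess f x"
    and diff: "\<And>x. x \<in> \<Omega> \<Longrightarrow> f differentiable (at x)" "\<And>x. x \<in> \<Omega> \<Longrightarrow> grad f differentiable (at x)"
    unfolding C2_up_to_def by blast
  have D1: "(f has_derivative (\<lambda>v. G x \<bullet> v)) (at x)" if "x \<in> \<Omega>" for x
    using has_derivative_grad[OF diff(1)] GH(4) that by simp
  have D2: "(G has_derivative hess_map (H x)) (at x)" if "x \<in> \<Omega>" for x
    using has_derivative_transform_within_open[OF has_derivative_hess[OF diff(2)] assms(1) that]
      GH(4,5) that by simp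
  show thesis
    by (rule that, rule C2_extension.intro) (fact assms GH D1 D2)+
qed

subsection \<open>Monotonicity of the slope\<close>

text \<open>Here \<open>f' = V / U\<close> on the graph, but \<open>G\<close> is differentiable only above it.  So the derivative of
  \<open>V / U\<close> is bounded below by a positive constant on the translates of the graph by \<open>t > 0\<close>,
  and the resulting growth estimate is passed to the limit \<open>t \<rightarrow> 0\<close>.\<close>

lemma slope_strict_mono:
  fixes T :: "plane \<Rightarrow> plane" and G :: "plane \<Rightarrow> plane"
  assumes T: "linear T" and "\<Omega> \<subseteq> A" and "0 < a" "0 < b"
    and f: "\<And>s. s \<in> {s0 - a<..<s0 + a} \<Longrightarrow> (f has_real_derivative f' s) (at s)"
    and f': "continuous_on {s0 - a<..<s0 + a} f'"
    and above: "\<And>s t. \<lbrakk>s \<in> {s0 - a<..<s0 + a}; 0 < t; t < b\<rbrakk> \<Longrightarrow> T (s, f s + t) \<in> \<Omega>"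
    and on: "\<And>s. s \<in> {s0 - a<..<s0 + a} \<Longrightarrow> T (s, f s) \<in> A"
    and G: "continuous_on A G" and H: "continuous_on A H"
    and D: "\<And>x. x \<in> \<Omega> \<Longrightarrow> (G has_derivative hess_map (H x)) (at x)"
    and tangential: "\<And>s. s \<in> {s0 - a<..<s0 + a} \<Longrightarrow>
      G (T (s, f s)) \<bullet> T (0, 1) = f' s * (G (T (s, f s)) \<bullet> T (1, 0))"
    and nonzero: "G (T (s0, f s0)) \<bullet> T (1, 0) \<noteq> 0"
    and pos: "0 < hess_map (H (T (s0, f s0))) (T (1, f' s0)) \<bullet> T (- f' s0, 1)
      / (G (T (s0, f s0)) \<bullet> T (1, 0))"
  shows "\<exists>d>0. d \<le> a \<and> strict_mono_on {s0 - d<..<s0 + d} f'"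
proof -
  define I where "I = {s0 - a<..<s0 + a}"
  \<comment> \<open>Coordinates that straighten the curve: \<open>t\<close> is the height above the
    graph. Differentiation is possible for \<open>t > 0\<close> only, continuity holds down to
    \<open>t = 0\<close>.\<close>
  define P where "P z = T (fst z, f (fst z) + snd z)" for z
  define U where "U z = G (P z) \<bullet> T (1, 0)" for z
  define V where "V z = G (P z) \<bullet> T (0, 1)" for z
  define B where "B z = hess_map (H (P z)) (T (1, f' (fst z)))" for z
  \<comment> \<open>The quotient rule for \<open>V / U\<close> along a translate of the graph with
    \<open>t\<close> fixed: its tangent is \<open>T (1, f' s)\<close>, and \<open>B\<close> is the
    derivative of \<open>G\<close> in that direction.\<close>
  define D1 where "D1 z = ((B z \<bullet> T (0, 1)) * U z - V z * (B z \<bullet> T (1, 0))) / (U z * U z)" for z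
  define Z where "Z = I \<times> {0..<b}"
  let ?z0 = "(s0, 0)"
  have s0: "s0 \<in> I" and z0: "?z0 \<in> Z"
    using \<open>0 < a\<close> \<open>0 < b\<close> by (auto simp: I_def Z_def)
  have contT: "continuous_on S T" for S
    using T by (simp add: linear_continuous_on linear_linear)
  have contf: "continuous_on I f"
    using f unfolding I_def by (meson DERIV_isCont continuous_at_imp_continuous_on)
  have contf': "continuous_on I f'"
    using f' by (simp add: I_def)
  have "fst ` Z \<subseteq> I" by (auto simp: Z_def)
  then have contZ: "continuous_on Z (\<lambda>z. f (fst z))" "continuous_on Z (\<lambda>z. f' (fst z))"
    by (auto intro!: continuous_on_compose2[OF contf] continuous_on_compose2[OF contf']
        continuous_intros)
  have contP: "continuous_on Z P"
    unfolding P_def by (rule continuous_on_compose2[OF contT[of UNIV]])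
      (auto intro!: continuous_intros contZ)
  have PA: "P ` Z \<subseteq> A"
  proof
    fix x assume "x \<in> P ` Z"
    then obtain s t where x: "x = T (s, f s + t)" "s \<in> I" "0 \<le> t" "t < b"
      by (auto simp: P_def Z_def)
    then show "x \<in> A"
      using above[of s t] on[of s] \<open>\<Omega> \<subseteq> A\<close> by (cases "t = 0") (auto simp: I_def)
  qed
  have contG: "continuous_on Z (\<lambda>z. G (P z))" and contH: "continuous_on Z (\<lambda>z. H (P z))"
    by (auto intro!: continuous_on_compose2[OF G contP PA] continuous_on_compose2[OF H contP PA])
  have contU: "continuous_on Z U" and contV: "continuous_on Z V"
    unfolding U_def V_def by (intro continuous_intros contG)+
  have "continuous_on Z (\<lambda>z. T (1, f' (fst z)))"
    by (rule continuous_on_compose2[OF contT[of UNIV]]) (auto intro!: continuous_intros contZ)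
  then have contB: "continuous_on Z B"
    unfolding B_def by (intro continuous_intros contH)
  have lim: "(h \<longlongrightarrow> h z) (at z within Z)" if "continuous_on Z h" "z \<in> Z"
    for h :: "real \<times> real \<Rightarrow> 'b::topological_space" and z
    using that by (simp add: continuous_on_def)
  have U0: "U ?z0 \<noteq> 0" using nonzero by (simp add: U_def P_def)
  \<comment> \<open>On the curve \<open>V = f' U\<close>, which collapses the numerator to
    \<open>U\<close> times the component of \<open>B\<close> along the normal
    \<open>T (- f' s0, 1)\<close>.\<close>
  have D10: "D1 ?z0 = hess_map (H (T (s0, f s0))) (T (1, f' s0)) \<bullet> T (- f' s0, 1)
      / (G (T (s0, f s0)) \<bullet> T (1, 0))"
  proof -
    have "T (- f' s0, 1) = T ((- f' s0) *\<^sub>R (1, 0) + (0, 1))" by simp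
    also have "\<dots> = (- f' s0) *\<^sub>R T (1, 0) + T (0, 1)"
      unfolding linear_add[OF T] linear_scale[OF T] ..
    finally have "B ?z0 \<bullet> T (- f' s0, 1) = B ?z0 \<bullet> T (0, 1) - f' s0 * (B ?z0 \<bullet> T (1, 0))"
      by (simp add: inner_diff_right)
    moreover have "V ?z0 = f' s0 * U ?z0"
      using tangential[of s0] s0 by (simp add: V_def U_def P_def I_def)
    ultimately have "(B ?z0 \<bullet> T (0, 1)) * U ?z0 - V ?z0 * (B ?z0 \<bullet> T (1, 0))
        = (B ?z0 \<bullet> T (- f' s0, 1)) * U ?z0"
      by (simp add: left_diff_distrib)
    then have "D1 ?z0 = (B ?z0 \<bullet> T (- f' s0, 1)) * U ?z0 / (U ?z0 * U ?z0)"
      by (simp add: D1_def)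
    then show ?thesis
      using U0 by (simp add: B_def U_def P_def)
  qed
  define \<delta> where "\<delta> = D1 ?z0 / 2"
  have \<delta>: "0 < \<delta>" "\<delta> < D1 ?z0" using pos D10 by (auto simp: \<delta>_def)
  have "(D1 \<longlongrightarrow> D1 ?z0) (at ?z0 within Z)"
    unfolding D1_def
    by (intro tendsto_intros lim contB contU contV z0) (use U0 in simp)
  then have "\<forall>\<^sub>F z in at ?z0 within Z. \<delta> < D1 z \<and> U z \<noteq> 0"
    using \<delta>(2) U0 tendsto_imp_eventually_ne[OF lim[OF contU z0]]
    by (intro eventually_conj order_tendstoD(1)) auto
  then obtain e where "e > 0"
    and e: "\<And>z. z \<in> Z \<Longrightarrow> dist z ?z0 < e \<Longrightarrow> \<delta> < D1 z \<and> U z \<noteq> 0"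
    unfolding eventually_at using \<delta> U0 by metis
  \<comment> \<open>\<open>e / 2\<close> because the distance to \<open>(s0, 0)\<close> is at most
    \<open>|s - s0| + |t| < 2 d\<close>.\<close>
  define d where "d = min (e / 2) (min a b)"
  have d: "d > 0" "d \<le> a" "d \<le> b" using \<open>e > 0\<close> \<open>0 < a\<close> \<open>0 < b\<close> by (auto simp: d_def)
  have near: "(s, t) \<in> Z \<and> \<delta> < D1 (s, t) \<and> U (s, t) \<noteq> 0"
    if "s \<in> {s0 - d<..<s0 + d}" "0 \<le> t" "t < d" for s t
  proof -
    have "dist (s, t) ?z0 \<le> \<bar>s - s0\<bar> + \<bar>t\<bar>"
      unfolding dist_Pair_Pair dist_real_def by (rule order_trans[OF sqrt_sum_squares_le_sum_abs]) simp
    also have "\<dots> < e" using that by (auto simp: d_def)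
    finally show ?thesis using e[of "(s, t)"] that d by (auto simp: Z_def I_def)
  qed
  define q where "q t s = V (s, t) / U (s, t)" for t s
  have deriv: "(q t has_real_derivative D1 (s, t)) (at s)"
    if s: "s \<in> {s0 - d<..<s0 + d}" and t: "0 < t" "t < d" for s t
  proof -
    have sI: "s \<in> {s0 - a<..<s0 + a}" using s d by auto
    have "((\<lambda>s. (s, f s + t)) has_derivative (\<lambda>h. (h, h * f' s))) (at s)"
      using f[OF sI] by (auto intro!: derivative_eq_intros simp: has_field_derivative_def mult.commute)
    then have "((\<lambda>s. T (s, f s + t)) has_derivative (\<lambda>h. T (h, h * f' s))) (at s)"
      by (rule bounded_linear.has_derivative[OF linear_linear[THEN iffD2, OF T]])
    moreover have "T (h, h * f' s) = h *\<^sub>R T (1, f' s)" for h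
      using linear_scale[OF T, of h "(1, f' s)"] by simp
    ultimately have "((\<lambda>s. T (s, f s + t)) has_derivative (\<lambda>h. h *\<^sub>R T (1, f' s))) (at s)"
      by simp
    from has_derivative_compose[OF this D[OF above[OF sI]]] t d
    have G': "((\<lambda>s. G (P (s, t))) has_derivative (\<lambda>h. h *\<^sub>R B (s, t))) (at s)"
      by (simp add: P_def B_def hess_map_scaleR)
    have "((\<lambda>s. G (P (s, t)) \<bullet> w) has_real_derivative B (s, t) \<bullet> w) (at s)" for w
      using has_derivative_inner_left[OF G', of w]
      by (simp add: has_field_derivative_def mult_commute_abs)
    then have "((\<lambda>s. U (s, t)) has_real_derivative B (s, t) \<bullet> T (1, 0)) (at s)"
      "((\<lambda>s. V (s, t)) has_real_derivative B (s, t) \<bullet> T (0, 1)) (at s)"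
      by (simp_all add: U_def V_def)
    from DERIV_divide[OF this(2) this(1)] near[OF s, of t] t show ?thesis
      by (simp add: q_def[abs_def] D1_def)
  qed
  have growth: "\<delta> * (s2 - s1) \<le> q t s2 - q t s1"
    if s: "s0 - d < s1" "s1 < s2" "s2 < s0 + d" and t: "0 < t" "t < d" for s1 s2 t
  proof -
    have "\<exists>z>s1. z < s2 \<and> q t s2 - q t s1 = (s2 - s1) * D1 (z, t)"
      by (rule MVT2) (use s t in \<open>auto intro!: deriv\<close>)
    then obtain z where z: "s1 < z" "z < s2" "q t s2 - q t s1 = (s2 - s1) * D1 (z, t)" by blast
    have "(s2 - s1) * \<delta> \<le> (s2 - s1) * D1 (z, t)"
      using near[of z t] z s t by (intro mult_left_mono) auto
    with z show ?thesis by (simp add: mult.commute)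
  qed
  have qlim: "((\<lambda>t. q t s) \<longlongrightarrow> f' s) (at_right 0)" if s: "s \<in> {s0 - d<..<s0 + d}" for s
  proof -
    have z: "(s, 0) \<in> Z" "U (s, 0) \<noteq> 0" using near[OF s, of 0] d by auto
    have "filterlim (\<lambda>t. (s, t)) (at (s, 0) within Z) (at_right 0)"
      unfolding filterlim_at
    proof
      show "\<forall>\<^sub>F t in at_right 0. (s, t) \<in> Z \<and> (s, t) \<noteq> (s, 0)"
        unfolding eventually_at_right_field using near[OF s] d(1) by (intro exI[of _ d]) auto
      show "((\<lambda>t. (s, t)) \<longlongrightarrow> (s, 0)) (at_right 0)"
        by (intro tendsto_intros)
    qed
    from filterlim_compose[OF lim[OF contU z(1)] this] filterlim_compose[OF lim[OF contV z(1)] this]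
    have "((\<lambda>t. q t s) \<longlongrightarrow> V (s, 0) / U (s, 0)) (at_right 0)"
      unfolding q_def by (intro tendsto_divide) (use z in auto)
    moreover have "V (s, 0) = f' s * U (s, 0)"
      using tangential[of s] s d by (simp add: V_def U_def P_def)
    ultimately show ?thesis using z by simp
  qed
  have "f' s1 < f' s2"
    if s: "s1 \<in> {s0 - d<..<s0 + d}" "s2 \<in> {s0 - d<..<s0 + d}" "s1 < s2" for s1 s2
  proof -
    \<comment> \<open>A strict inequality could degenerate as \<open>t\<close> tends to 0; the bound
      by \<open>\<delta>\<close>, which is independent of \<open>t\<close>, keeps its
      strength.\<close>
    have "\<delta> * (s2 - s1) \<le> f' s2 - f' s1"
    proof (rule tendsto_lowerbound)
      show "((\<lambda>t. q t s2 - q t s1) \<longlongrightarrow> f' s2 - f' s1) (at_right 0)"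
        by (intro tendsto_diff qlim s)
      show "\<forall>\<^sub>F t in at_right 0. \<delta> * (s2 - s1) \<le> q t s2 - q t s1"
        unfolding eventually_at_right_field using growth s d by (intro exI[of _ d]) auto
    qed simp
    with \<delta> s(3) show ?thesis
      by (smt (verit) mult_pos_pos)
  qed
  then have "strict_mono_on {s0 - d<..<s0 + d} f'"
    by (rule strict_mono_onI)
  with d show ?thesis by blast
qed

text \<open>Differentiability at 0 is not assumed, only a limit of \<open>g'\<close>. If
  \<open>l < 0\<close>, then \<open>g\<close> decreases strictly from \<open>g 0 = 0\<close> on a
  short interval, against its positivity.\<close>

lemma one_sided_derivative_nonneg:
  fixes g :: "real \<Rightarrow> real"
  assumes "0 < d" "g 0 = 0"
    and pos: "\<And>t. 0 < t \<Longrightarrow> t < d \<Longrightarrow> 0 < g t"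
    and deriv: "\<And>t. 0 < t \<Longrightarrow> t < d \<Longrightarrow> (g has_real_derivative g' t) (at t)"
    and cont: "continuous_on {0..<d} g"
    and lim: "(g' \<longlongrightarrow> l) (at_right 0)"
  shows "0 \<le> l"
proof (rule ccontr)
  assume "\<not> 0 \<le> l"
  then have "\<forall>\<^sub>F t in at_right 0. g' t < 0"
    using lim by (intro order_tendstoD) auto
  then obtain e where e: "e > 0" "\<And>t. 0 < t \<Longrightarrow> t < e \<Longrightarrow> g' t < 0"
    by (auto simp: eventually_at_right_field)
  define h where "h = min d e / 2"
  have h: "0 < h" "h < d" "h < e" using \<open>0 < d\<close> e by (auto simp: h_def min_def)
  have "g h < g 0"
  proof (rule DERIV_neg_imp_decreasing_open[OF h(1)])
    show "\<exists>y. (g has_real_derivative y) (at x) \<and> y < 0" if "0 < x" "x < h" for x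
      using deriv[of x] e(2)[of x] that h by auto
    show "continuous_on {0..h} g"
      by (rule continuous_on_subset[OF cont]) (use h in auto)
  qed
  with pos[of h] h \<open>g 0 = 0\<close> show False by simp
qed

subsection \<open>The two sides of the pseudo-sonic curve\<close>

text \<open>The inverse of \<open>T\<close> is its adjoint. This converts the components in
  \<open>normal_part\<close>, taken through \<open>inv T\<close>, into inner products with images
  under \<open>T\<close>.\<close>

lemma inner_orthogonal_transformation:
  fixes T :: "'a::euclidean_space \<Rightarrow> 'a"
  assumes "orthogonal_transformation T"
  shows "v \<bullet> T w = inv T v \<bullet> w"
proof -
  have "T (inv T v) = v"
    using assms by (simp add: orthogonal_transformation_surj surj_f_inv_f)
  then show ?thesis
    using assms by (metis orthogonal_transformation_def)
qed

lemma graph_chart_at: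
  assumes "graph_chart \<Gamma> Q T r l1 l2 f" "Q \<in> \<Gamma>"
  shows "fst (inv T Q) \<in> {l1<..<l2}" "T (fst (inv T Q), f (fst (inv T Q))) = Q"
proof -
  have T: "inv T (T z) = z" for z
    using assms(1) by (simp add: graph_chart_def orthogonal_transformation_inj inv_f_f)
  have "Q \<in> T ` {(\<xi>, f \<xi>) |\<xi>. l1 < \<xi> \<and> \<xi> < l2}"
    using assms by (fastforce simp: graph_chart_def)
  then obtain s where "Q = T (s, f s)" "l1 < s" "s < l2"
    by blast
  then show "fst (inv T Q) \<in> {l1<..<l2}" "T (fst (inv T Q), f (fst (inv T Q))) = Q"
    by (simp_all add: T)
qed

text \<open>A smaller ball suffices, the graph being the same. Tangency is assumed for charts
  centred at the point in question; with this it holds along the graph for a single \<open>T\<close>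
  and \<open>f\<close>.\<close>

lemma graph_chart_shift:
  assumes "graph_chart \<Gamma> Q T r l1 l2 f" "x \<in> ball Q r"
  shows "\<exists>r'. graph_chart \<Gamma> x T r' l1 l2 f"
proof -
  obtain r' where r': "0 < r'" "ball x r' \<subseteq> ball Q r"
    using assms(2) open_contains_ball[of "ball Q r"] open_ball by blast
  have "\<Gamma> \<inter> ball x r' = T ` {(\<xi>, f \<xi>) |\<xi>. l1 < \<xi> \<and> \<xi> < l2} \<inter> ball x r'"
    using assms(1) r'(2) unfolding graph_chart_def by blast
  with assms(1) r'(1) show ?thesis
    unfolding graph_chart_def by blast
qed

text \<open>Reflecting the second coordinate exchanges the two sides of the graph, so that
  \<open>\<Omega>m\<close> may be taken to lie above it.\<close>

lemma graph_chart_reflect: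
  assumes "graph_chart \<Gamma> Q T r l1 l2 f"
  shows "graph_chart \<Gamma> Q (\<lambda>z. T (fst z, - snd z)) r l1 l2 (\<lambda>s. - f s)"
proof -
  let ?R = "\<lambda>z::plane. (fst z, - snd z)"
  have T: "orthogonal_transformation T" and f: "C11_on {l1<..<l2} f"
    using assms by (auto simp: graph_chart_def)
  have "linear ?R"
    by (rule linearI) auto
  then have "orthogonal_transformation ?R"
    by (simp add: orthogonal_transformation_def inner_prod_def)
  then have "orthogonal_transformation (\<lambda>z. T (?R z))"
    using orthogonal_transformation_compose[OF T] by (simp add: o_def)
  moreover have "C11_on {l1<..<l2} (\<lambda>s. - f s)"
  proof -
    obtain L where L: "L-lipschitz_on {l1<..<l2} (deriv f)"
      and diff: "\<And>t. t \<in> {l1<..<l2} \<Longrightarrow> f differentiable (at t)"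
      using f by (auto simp: C11_on_def)
    have "deriv (\<lambda>s. - f s) t = - deriv f t" if "t \<in> {l1<..<l2}" for t
      using diff[OF that] by (intro DERIV_imp_deriv DERIV_minus)
        (simp add: DERIV_deriv_iff_real_differentiable)
    with L have "L-lipschitz_on {l1<..<l2} (deriv (\<lambda>s. - f s))"
      by (auto simp: lipschitz_on_def dist_minus)
    with diff show ?thesis
      by (auto simp: C11_on_def)
  qed
  moreover have "(\<lambda>z. T (?R z)) ` {(\<xi>, - f \<xi>) |\<xi>. l1 < \<xi> \<and> \<xi> < l2}
      = T ` {(\<xi>, f \<xi>) |\<xi>. l1 < \<xi> \<and> \<xi> < l2}"
    by (force simp: image_iff)
  ultimately show ?thesis
    using assms by (simp add: graph_chart_def)
qed

section \<open>Local topology of the interface\<close>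

context sonic_configuration
begin

lemma sonic_subset: "\<Gamma> \<subseteq> S"
  unfolding \<Gamma>_eq curve_interior_def using openin_imp_subset by fastforce

text \<open>A neighbourhood in \<open>S\<close> that is homeomorphic to an open interval consists of
  interior points itself, so endpoints of \<open>S\<close> keep away from \<open>Q\<close>.\<close>

lemma sonic_interior_near:
  assumes "Q \<in> \<Gamma>"
  shows "\<exists>r>0. S \<inter> ball Q r \<subseteq> \<Gamma>"
proof -
  obtain N where N: "openin (top_of_set S) N" "Q \<in> N" "N homeomorphic {0<..<1::real}"
    using assms unfolding \<Gamma>_eq curve_interior_def by blast
  then have "N \<subseteq> \<Gamma>"
    unfolding \<Gamma>_eq curve_interior_def by blast
  moreover obtain r where "r > 0" "ball Q r \<inter> S \<subseteq> N"
    using N(1,2) openin_contains_ball[of S N] by blast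
  ultimately show ?thesis by blast
qed

lemma minus_extension: obtains G H where "C2_extension \<Omega>m (closure \<Omega>m) \<phi>m G H"
  using C2_up_to_extension[OF open_minus closure_subset order_refl regular_minus] .

lemma plus_extension: obtains G H where "C2_extension \<Omega>p (\<Omega>p \<union> \<Gamma>) \<phi>p G H"
  using C2_up_to_extension[OF open_plus _ _ regular_plus] interface(3) closure_subset by blast

text \<open>A point of one open region is outside the closure of the other, so it could be sonic
  only as seen from its own side, where the strict inequality between \<open>|D\<phi>|\<close> and
  \<open>c\<close> forbids it.\<close>

lemma disjoint_sonic: "\<Omega>m \<inter> S = {}" "\<Omega>p \<inter> S = {}"
proof -
  have cl: "\<Omega>m \<inter> closure \<Omega>p = {}" "\<Omega>p \<inter> closure \<Omega>m = {}"
    using disjoint open_minus open_plus open_Int_closure_eq_empty by blast+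
  show "\<Omega>m \<inter> S = {}"
  proof (rule ccontr)
    assume "\<Omega>m \<inter> S \<noteq> {}"
    then obtain x where x: "x \<in> \<Omega>m" "x \<in> S" by blast
    obtain G H where "C2_extension \<Omega>m (closure \<Omega>m) \<phi>m G H" by (rule minus_extension)
    then interpret C2_extension \<Omega>m "closure \<Omega>m" \<phi>m G H .
    have "pseudo_sonic_from \<gamma> K \<Omega>m \<phi>m x"
      using x cl unfolding S_eq pseudo_sonic_set_def pseudo_sonic_from_def by blast
    from pseudo_sonic_fromD[OF this] x(1) supersonic show False
      using closure_subset grad_eq by (metis less_irrefl subsetD)
  qed
  show "\<Omega>p \<inter> S = {}"
  proof (rule ccontr)
    assume "\<Omega>p \<inter> S \<noteq> {}"
    then obtain x where x: "x \<in> \<Omega>p" "x \<in> S" by blast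
    obtain G H where "C2_extension \<Omega>p (\<Omega>p \<union> \<Gamma>) \<phi>p G H" by (rule plus_extension)
    then interpret C2_extension \<Omega>p "\<Omega>p \<union> \<Gamma>" \<phi>p G H .
    have "pseudo_sonic_from \<gamma> K \<Omega>p \<phi>p x"
      using x cl unfolding S_eq pseudo_sonic_set_def pseudo_sonic_from_def by blast
    from pseudo_sonic_fromD[OF this] x(1) subsonic show False
      using grad_eq by (metis UnI1 less_irrefl)
  qed
qed

text \<open>Membership in \<open>S\<close> may stem from either side; if it stems from the subsonic
  one, \<open>matching\<close> carries the equality over.\<close>

lemma sonic_on_interface:
  assumes "x \<in> \<Gamma>"
  shows "norm (grad_from \<Omega>m \<phi>m x) = sonic_speed \<gamma> K (\<phi>m x) (grad_from \<Omega>m \<phi>m x)"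
proof -
  obtain G H where "C2_extension \<Omega>m (closure \<Omega>m) \<phi>m G H" by (rule minus_extension)
  then interpret m: C2_extension \<Omega>m "closure \<Omega>m" \<phi>m G H .
  obtain G' H' where "C2_extension \<Omega>p (\<Omega>p \<union> \<Gamma>) \<phi>p G' H'" by (rule plus_extension)
  then interpret p: C2_extension \<Omega>p "\<Omega>p \<union> \<Gamma>" \<phi>p G' H' .
  have "pseudo_sonic_from \<gamma> K \<Omega>m \<phi>m x \<or> pseudo_sonic_from \<gamma> K \<Omega>p \<phi>p x"
    using assms sonic_subset unfolding S_eq pseudo_sonic_set_def by blast
  then show ?thesis
  proof
    assume "pseudo_sonic_from \<gamma> K \<Omega>m \<phi>m x"
    then show ?thesis
      using m.pseudo_sonic_fromD m.grad_from_eq assms interface(2) by (metis subsetD)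
  next
    assume "pseudo_sonic_from \<gamma> K \<Omega>p \<phi>p x"
    then show ?thesis
      using p.pseudo_sonic_fromD p.grad_from_eq assms matching by (metis UnI2)
  qed
qed

text \<open>A box around the graph is cut by it into two connected halves without sonic points. Each
  half lies in one region, and the regions differ because both accumulate at
  \<open>Q\<close>.\<close>

lemma chart_sides:
  assumes "graph_chart \<Gamma> Q T r l1 l2 f" "Q \<in> \<Gamma>"
  defines "s0 \<equiv> fst (inv T Q)"
  obtains a b e where "0 < a" "0 < b" "0 < e" "{s0 - a<..<s0 + a} \<subseteq> {l1<..<l2}"
    "\<And>x. x \<in> ball Q e \<Longrightarrow> fst (inv T x) \<in> {s0 - a<..<s0 + a} \<and>
        \<bar>snd (inv T x) - f (fst (inv T x))\<bar> < b"
    "\<And>s. s \<in> {s0 - a<..<s0 + a} \<Longrightarrow> T (s, f s) \<in> \<Gamma> \<inter> ball Q r"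
    "(\<forall>s\<in>{s0 - a<..<s0 + a}. \<forall>t\<in>{0<..<b}. T (s, f s + t) \<in> \<Omega>m \<and> T (s, f s - t) \<in> \<Omega>p) \<or>
     (\<forall>s\<in>{s0 - a<..<s0 + a}. \<forall>t\<in>{0<..<b}. T (s, f s + t) \<in> \<Omega>p \<and> T (s, f s - t) \<in> \<Omega>m)"
proof -
  have T: "orthogonal_transformation T" and "r > 0" and f: "C11_on {l1<..<l2} f"
    and graph: "\<Gamma> \<inter> ball Q r = T ` {(\<xi>, f \<xi>) |\<xi>. l1 < \<xi> \<and> \<xi> < l2} \<inter> ball Q r"
    using assms(1) by (auto simp: graph_chart_def)
  have inv1: "inv T (T z) = z" and inv2: "T (inv T z) = z" for z
    using T by (simp_all add: orthogonal_transformation_inj orthogonal_transformation_surj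
        inv_f_f surj_f_inv_f)
  have contT: "continuous_on X T" "continuous_on X (inv T)" for X
    using T orthogonal_transformation_inv[OF T]
    by (simp_all add: orthogonal_transformation_linear linear_continuous_on linear_linear)
  have s0: "s0 \<in> {l1<..<l2}" and Q: "T (s0, f s0) = Q"
    using graph_chart_at[OF assms(1,2)] by (simp_all add: s0_def)
  have contf: "continuous_on {l1<..<l2} f"
    using f unfolding C11_on_def
    by (metis continuous_at_imp_continuous_on differentiable_imp_continuous_within)
  define P where "P z = T (fst z, f (fst z) + snd z)" for z
  have contP: "continuous_on ({l1<..<l2} \<times> UNIV) P"
    unfolding P_def
    by (rule continuous_on_compose2[OF contT(1)[of UNIV]])
      (auto intro!: continuous_intros continuous_on_compose2[OF contf])
  obtain r1 where r1: "r1 > 0" "S \<inter> ball Q r1 \<subseteq> \<Gamma>"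
    using sonic_interior_near[OF assms(2)] by blast
  have Q_int: "Q \<in> interior \<Lambda>" using assms(2) interface by blast
  \<comment> \<open>In \<open>ball Q r\<close> the set \<open>\<Gamma>\<close> is the graph, in
    \<open>ball Q r1\<close> there is no point of \<open>S\<close> outside \<open>\<Gamma>\<close>,
    and \<open>interior \<Lambda>\<close> is covered by the regions and \<open>S\<close>. Hence
    points of this set off the graph belong to a region.\<close>
  let ?B = "ball Q r \<inter> ball Q r1 \<inter> interior \<Lambda>"
  have "open (P -` ?B \<inter> ({l1<..<l2} \<times> UNIV))"
    unfolding Int_commute[of "P -` _"]
    by (rule continuous_open_preimage[OF contP]) (auto intro: open_Times)
  moreover have "(s0, 0) \<in> P -` ?B \<inter> ({l1<..<l2} \<times> UNIV)"
    using s0 Q Q_int \<open>r > 0\<close> r1 by (simp add: P_def)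
  ultimately obtain X Y where XY: "open X" "open Y" "s0 \<in> X" "0 \<in> Y"
    "X \<times> Y \<subseteq> P -` ?B \<inter> ({l1<..<l2} \<times> UNIV)"
    unfolding open_prod_def by (metis mem_Times_iff fst_conv snd_conv)
  obtain a where a: "a > 0" "ball s0 a \<subseteq> X" using XY open_contains_ball by metis
  obtain b where b: "b > 0" "ball 0 b \<subseteq> Y" using XY open_contains_ball by metis
  define I where "I = {s0 - a<..<s0 + a}"
  have I: "I \<subseteq> {l1<..<l2}"
  proof
    fix s assume "s \<in> I"
    then have "(s, 0) \<in> X \<times> Y"
      using a XY(4) by (auto simp: I_def ball_eq_greaterThanLessThan subset_iff)
    with XY(5) show "s \<in> {l1<..<l2}" by auto
  qed
  have inB: "T (s, f s + t) \<in> ?B" if "s \<in> I" "\<bar>t\<bar> < b" for s t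
  proof -
    have "(s, t) \<in> X \<times> Y"
      using that a b by (auto simp: I_def ball_eq_greaterThanLessThan subset_iff abs_less_iff)
    then show ?thesis using XY(5) by (auto simp: P_def)
  qed
  have on: "T (s, f s) \<in> \<Gamma> \<inter> ball Q r" if "s \<in> I" for s
  proof -
    have "T (s, f s) \<in> T ` {(\<xi>, f \<xi>) |\<xi>. l1 < \<xi> \<and> \<xi> < l2}"
      using I that by auto
    with inB[OF that, of 0] b graph show ?thesis by auto
  qed
  have off: "T (s, f s + t) \<in> \<Omega>m \<union> \<Omega>p" if "s \<in> I" "\<bar>t\<bar> < b" "t \<noteq> 0" for s t
  proof -
    have "T (s, f s + t) \<notin> \<Gamma>"
    proof
      assume "T (s, f s + t) \<in> \<Gamma>"
      then have "T (s, f s + t) \<in> T ` {(\<xi>, f \<xi>) |\<xi>. l1 < \<xi> \<and> \<xi> < l2}"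
        using graph inB[OF that(1,2)] by blast
      then obtain \<xi> where "T (s, f s + t) = T (\<xi>, f \<xi>)" by blast
      then have "(s, f s + t) = (\<xi>, f \<xi>)" by (metis inv1)
      then have "s = \<xi>" "f s + t = f \<xi>" by blast+
      then have "t = 0" by simp
      with that(3) show False by simp
    qed
    with inB[OF that(1,2)] r1 regions(2) show ?thesis by blast
  qed
  have one_side: "P ` (I \<times> J) \<subseteq> \<Omega>m \<or> P ` (I \<times> J) \<subseteq> \<Omega>p"
    if J: "J = {0<..<b} \<or> J = {-b<..<0}" for J
  proof -
    have "connected (P ` (I \<times> J))"
      using J I by (intro connected_continuous_image continuous_on_subset[OF contP]
          connected_Times) (auto simp: I_def)
    moreover have "P ` (I \<times> J) \<subseteq> \<Omega>m \<union> \<Omega>p"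
    proof
      fix x assume "x \<in> P ` (I \<times> J)"
      then obtain s t where st: "s \<in> I" "t \<in> J" "x = T (s, f s + t)"
        by (auto simp: P_def)
      then have "\<bar>t\<bar> < b" "t \<noteq> 0" using J by auto
      then show "x \<in> \<Omega>m \<union> \<Omega>p" unfolding st(3) by (rule off[OF st(1)])
    qed
    ultimately show ?thesis
      using connectedD[of "P ` (I \<times> J)" \<Omega>m \<Omega>p] open_minus open_plus disjoint by blast
  qed
  \<comment> \<open>Conversely, by continuity of \<open>inv T\<close> and \<open>f\<close>, a full
    ball around \<open>Q\<close> has its coordinates in the box.\<close>
  have "\<forall>\<^sub>F x in nhds Q. fst (inv T x) \<in> I \<and> \<bar>snd (inv T x) - f (fst (inv T x))\<bar> < b"
  proof -
    have "isCont (inv T) Q"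
      using contT(2)[of UNIV] unfolding continuous_on_eq_continuous_at[OF open_UNIV] by blast
    then have "(inv T \<longlongrightarrow> inv T Q) (nhds Q)"
      by (simp only: isCont_def tendsto_nhds_iff)
    then have l: "((\<lambda>x. fst (inv T x)) \<longlongrightarrow> s0) (nhds Q)" "((\<lambda>x. snd (inv T x)) \<longlongrightarrow> f s0) (nhds Q)"
      using tendsto_fst[of "inv T" "inv T Q"] tendsto_snd[of "inv T" "inv T Q"]
      by (simp_all add: Q[symmetric] inv1)
    have "isCont f s0"
      using contf s0 by (simp add: continuous_on_eq_continuous_at)
    from isCont_tendsto_compose[OF this l(1)] l(2)
    have "((\<lambda>x. snd (inv T x) - f (fst (inv T x))) \<longlongrightarrow> f s0 - f s0) (nhds Q)"
      by (intro tendsto_diff)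
    then have "\<forall>\<^sub>F x in nhds Q. \<bar>snd (inv T x) - f (fst (inv T x))\<bar> < b"
      using b tendstoD by fastforce
    moreover have "\<forall>\<^sub>F x in nhds Q. fst (inv T x) \<in> I"
      by (rule topological_tendstoD[OF l(1)]) (use a in \<open>auto simp: I_def\<close>)
    ultimately show ?thesis by (simp add: eventually_conj)
  qed
  then obtain e where e: "e > 0" and near: "\<And>x. x \<in> ball Q e \<Longrightarrow>
      fst (inv T x) \<in> I \<and> \<bar>snd (inv T x) - f (fst (inv T x))\<bar> < b"
    unfolding eventually_nhds_metric by (auto simp: dist_commute)
  define Up where "Up = P ` (I \<times> {0<..<b})"
  define Lo where "Lo = P ` (I \<times> {-b<..<0})"
  have cover: "x \<in> Up \<or> x \<in> Lo" if "x \<in> ball Q e" "x \<notin> \<Gamma>" for x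
  proof -
    let ?s = "fst (inv T x)" and ?t = "snd (inv T x) - f (fst (inv T x))"
    have x: "P (?s, ?t) = x" by (simp add: P_def inv2)
    have "?t \<noteq> 0"
    proof
      assume "?t = 0"
      then have "T (?s, f ?s) = x" using x by (simp add: P_def)
      with on[of ?s] near[OF that(1)] that(2) show False by simp
    qed
    then have "(?s, ?t) \<in> I \<times> {0<..<b} \<or> (?s, ?t) \<in> I \<times> {-b<..<0}"
      using near[OF that(1)] by auto
    then show ?thesis
      unfolding Up_def Lo_def using imageI[of "(?s, ?t)" _ P, unfolded x] by blast
  qed
  have meets: "\<exists>x. x \<in> ball Q e \<and> x \<in> W" if "Q \<in> closure W" for W
    using that e closure_approachable[of Q W] by (metis dist_commute mem_ball)
  \<comment> \<open>Each region meets the ball off the curve, hence meets a half box; since a half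
    lies in a single region, the halves must be shared out between the two.\<close>
  have "Q \<in> closure \<Omega>m" "Q \<in> closure \<Omega>p"
    using assms(2) interface by blast+
  then obtain x y where x: "x \<in> ball Q e" "x \<in> \<Omega>m" and y: "y \<in> ball Q e" "y \<in> \<Omega>p"
    using meets by blast
  then have "x \<notin> \<Gamma>" "y \<notin> \<Gamma>" using disjoint_sonic sonic_subset by blast+
  then have xy: "x \<in> Up \<or> x \<in> Lo" "y \<in> Up \<or> y \<in> Lo"
    using cover x(1) y(1) by blast+
  have "Up \<subseteq> \<Omega>m \<or> Up \<subseteq> \<Omega>p" "Lo \<subseteq> \<Omega>m \<or> Lo \<subseteq> \<Omega>p"
    using one_side[of "{0<..<b}"] one_side[of "{-b<..<0}"] by (simp_all add: Up_def Lo_def)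
  with xy x(2) y(2) disjoint have "(Up \<subseteq> \<Omega>m \<and> Lo \<subseteq> \<Omega>p) \<or> (Up \<subseteq> \<Omega>p \<and> Lo \<subseteq> \<Omega>m)"
    by blast
  moreover have "T (s, f s + t) \<in> Up" "T (s, f s - t) \<in> Lo" if "s \<in> I" "t \<in> {0<..<b}" for s t
  proof -
    have "P (s, t) \<in> Up" "P (s, - t) \<in> Lo"
      unfolding Up_def Lo_def using that by auto
    then show "T (s, f s + t) \<in> Up" "T (s, f s - t) \<in> Lo"
      by (simp_all add: P_def)
  qed
  ultimately have "(\<forall>s\<in>I. \<forall>t\<in>{0<..<b}. T (s, f s + t) \<in> \<Omega>m \<and> T (s, f s - t) \<in> \<Omega>p) \<or>
     (\<forall>s\<in>I. \<forall>t\<in>{0<..<b}. T (s, f s + t) \<in> \<Omega>p \<and> T (s, f s - t) \<in> \<Omega>m)"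
    by blast
  with a b e I near on show thesis
    by (intro that[of a b e]) (simp_all add: I_def)
qed

end

subsection \<open>Strict convexity\<close>

text \<open>The mean value theorem on both sides of the intermediate point \<open>z\<close> gives
  slopes \<open>f' c < f' d\<close>. As \<open>z - x = u (y - x)\<close> and
  \<open>y - z = (1 - u) (y - x)\<close>, multiplying by \<open>u (1 - u) (y - x)\<close> yields the
  chord inequality.\<close>

lemma strict_mono_deriv_imp_strictly_convex:
  fixes f :: "real \<Rightarrow> real"
  assumes deriv: "\<And>s. s \<in> {a<..<b} \<Longrightarrow> (f has_real_derivative f' s) (at s)"
    and mono: "strict_mono_on {a<..<b} f'"
    and xy: "x \<in> {a<..<b}" "y \<in> {a<..<b}" "x < y" and u: "0 < u" "u < 1"
  shows "f ((1 - u) * x + u * y) < (1 - u) * f x + u * f y"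
proof -
  define z where "z = (1 - u) * x + u * y"
  have zx: "z - x = u * (y - x)" and yz: "y - z = (1 - u) * (y - x)"
    by (simp_all add: z_def algebra_simps)
  have "0 < z - x" "0 < y - z"
    unfolding zx yz using u xy(3) by simp_all
  then have "x < z" "z < y"
    by simp_all
  have "\<exists>c>x. c < z \<and> f z - f x = (z - x) * f' c"
    by (rule MVT2[OF \<open>x < z\<close>]) (use xy \<open>z < y\<close> in \<open>auto intro!: deriv\<close>)
  then obtain c where c: "x < c" "c < z" "f z - f x = (z - x) * f' c" by blast
  have "\<exists>d>z. d < y \<and> f y - f z = (y - z) * f' d"
    by (rule MVT2[OF \<open>z < y\<close>]) (use xy \<open>x < z\<close> in \<open>auto intro!: deriv\<close>)
  then obtain d where d: "z < d" "d < y" "f y - f z = (y - z) * f' d" by blast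
  have "f' c < f' d"
    by (rule strict_mono_onD[OF mono]) (use c d xy in auto)
  then have "u * (1 - u) * (y - x) * f' c < u * (1 - u) * (y - x) * f' d"
    using u xy(3) by (intro mult_strict_left_mono) auto
  moreover have "(1 - u) * (f z - f x) = u * (1 - u) * (y - x) * f' c"
    "u * (f y - f z) = u * (1 - u) * (y - x) * f' d"
    unfolding c(3) d(3) zx yz by (simp_all add: mult_ac)
  ultimately have "(1 - u) * (f z - f x) < u * (f y - f z)"
    by linarith
  then have "f z < (1 - u) * f x + u * f y"
    by (simp add: algebra_simps)
  then show ?thesis
    by (simp add: z_def)
qed

text \<open>Endpoints on or above the graph serve two purposes at once: convexity of the region
  (endpoints in \<open>\<Omega>m\<close>) and strictness of chords (endpoints on the curve).\<close>

lemma open_segment_above_graph: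
  fixes f :: "real \<Rightarrow> real" and p q :: plane
  assumes deriv: "\<And>s. s \<in> {a<..<b} \<Longrightarrow> (f has_real_derivative f' s) (at s)"
    and mono: "strict_mono_on {a<..<b} f'"
    and pq: "fst p \<in> {a<..<b}" "fst q \<in> {a<..<b}" "p \<noteq> q" "f (fst p) \<le> snd p" "f (fst q) \<le> snd q"
    and z: "z \<in> open_segment p q"
  shows "f (fst z) < snd z"
proof -
  have le: "f (fst z) < snd z"
    if pq: "fst p \<in> {a<..<b}" "fst q \<in> {a<..<b}" "fst p < fst q" "f (fst p) \<le> snd p" "f (fst q) \<le> snd q"
      and z: "z \<in> open_segment p q" for p q z :: plane
  proof -
    obtain u where u: "0 < u" "u < 1" "z = (1 - u) *\<^sub>R p + u *\<^sub>R q"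
      using z by (auto simp: in_segment)
    have "f (fst z) < (1 - u) * f (fst p) + u * f (fst q)"
      using strict_mono_deriv_imp_strictly_convex[OF deriv mono pq(1-3) u(1,2)] u(3) by simp
    also have "\<dots> \<le> (1 - u) * snd p + u * snd q"
      using u pq by (intro add_mono mult_left_mono) auto
    finally show ?thesis using u(3) by simp
  qed
  consider "fst p < fst q" | "fst q < fst p" | "fst p = fst q" by linarith
  then show ?thesis
  proof cases
    case 1
    then show ?thesis using le pq z by blast
  next
    case 2
    then show ?thesis using le[of q p z] pq z by (simp add: open_segment_commute)
  next
    case 3
    obtain u where u: "0 < u" "u < 1" "z = (1 - u) *\<^sub>R p + u *\<^sub>R q"
      using z by (auto simp: in_segment)
    have "fst z = (1 - u) * fst p + u * fst q"
      using u(3) by simp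
    then have fst_z: "fst z = fst p"
      using 3 by (simp add: algebra_simps)
    \<comment> \<open>On a vertical segment the convexity of \<open>f\<close> gives nothing; two
      distinct endpoints cannot both lie on the graph, and the higher one supplies the
      strictness.\<close>
    have "snd p \<noteq> snd q" using pq(3) 3 by (simp add: prod_eq_iff)
    have ineq: "(1 - u) * f (fst p) \<le> (1 - u) * snd p" "u * f (fst p) \<le> u * snd q"
      using u pq 3 by (intro mult_left_mono; simp)+
    have "(1 - u) * f (fst p) < (1 - u) * snd p \<or> u * f (fst p) < u * snd q"
      using u pq 3 \<open>snd p \<noteq> snd q\<close> by auto
    with ineq have "(1 - u) * f (fst p) + u * f (fst p) < (1 - u) * snd p + u * snd q"
      by linarith
    moreover have "snd z = (1 - u) * snd p + u * snd q"
      using u(3) by simp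
    ultimately show ?thesis
      using fst_z by (simp add: algebra_simps)
  qed
qed

section \<open>Sign of the curvature and convexity near a point of the curve\<close>

context sonic_configuration
begin

text \<open>Provides the hypotheses of \<open>slope_strict_mono\<close> at \<open>Q\<close>. The
  decisive one is \<open>0 < k\<close>, obtained as \<open>k \<noteq> 0\<close> from the sonic speed
  and \<open>0 \<le> k\<close> from the sign of \<open>g\<close>.\<close>

lemma slope_strict_mono_near:
  assumes "\<gamma> > 1"
    and tangential: "tangential_along \<Gamma> (grad_from \<Omega>m \<phi>m)"
    and normal: "normal_derivative_nonzero \<Gamma> \<Omega>m (speed_field \<gamma> K \<Omega>m \<phi>m)"
    and chart: "graph_chart \<Gamma> Q T r l1 l2 f" and Q: "Q \<in> \<Gamma>"
    and s0: "s0 = fst (inv T Q)"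
    and abe: "0 < a" "0 < b" "0 < e" and sub: "{s0 - a<..<s0 + a} \<subseteq> {l1<..<l2}"
    and near: "\<And>x. x \<in> ball Q e \<Longrightarrow> fst (inv T x) \<in> {s0 - a<..<s0 + a} \<and>
        \<bar>snd (inv T x) - f (fst (inv T x))\<bar> < b"
    and on: "\<And>s. s \<in> {s0 - a<..<s0 + a} \<Longrightarrow> T (s, f s) \<in> \<Gamma> \<inter> ball Q r"
    and above: "\<And>s t. s \<in> {s0 - a<..<s0 + a} \<Longrightarrow> 0 < t \<Longrightarrow> t < b \<Longrightarrow> T (s, f s + t) \<in> \<Omega>m"
  shows "\<exists>d>0. d \<le> a \<and> strict_mono_on {s0 - d<..<s0 + d} (deriv f)"
proof -
  obtain G H where "C2_extension \<Omega>m (closure \<Omega>m) \<phi>m G H" by (rule minus_extension)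
  then interpret C2_extension \<Omega>m "closure \<Omega>m" \<phi>m G H .
  have T: "orthogonal_transformation T" and C11: "C11_on {l1<..<l2} f"
    using chart by (auto simp: graph_chart_def)
  have lin: "linear T" using T by (rule orthogonal_transformation_linear)
  have inv1: "inv T (T z) = z" and inv2: "T (inv T z) = z" for z
    using T by (simp_all add: orthogonal_transformation_inj orthogonal_transformation_surj
        inv_f_f surj_f_inv_f)
  note inner_T = inner_orthogonal_transformation[OF T]
  have s0_in: "s0 \<in> {s0 - a<..<s0 + a}" using abe by auto
  have TQ: "T (s0, f s0) = Q" using graph_chart_at(2)[OF chart Q] s0 by simp
  have deriv_f: "(f has_real_derivative deriv f s) (at s)" if "s \<in> {l1<..<l2}" for s
    using C11 that by (simp add: C11_on_def DERIV_deriv_iff_real_differentiable)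
  have cont_f': "continuous_on {l1<..<l2} (deriv f)"
    using C11 lipschitz_on_continuous_on unfolding C11_on_def by blast
  have cl: "x \<in> closure \<Omega>m" if "x \<in> \<Gamma>" for x
    using that interface by blast
  have tang: "G (T (s, f s)) \<bullet> T (0, 1) = deriv f s * (G (T (s, f s)) \<bullet> T (1, 0))"
    if s: "s \<in> {s0 - a<..<s0 + a}" for s
  proof -
    have x: "T (s, f s) \<in> \<Gamma>" "T (s, f s) \<in> ball Q r" using on[OF s] by auto
    obtain r' where "graph_chart \<Gamma> (T (s, f s)) T r' l1 l2 f"
      using graph_chart_shift[OF chart x(2)] by blast
    with tangential x(1) have "normal_part T f (T (s, f s)) (grad_from \<Omega>m \<phi>m (T (s, f s))) = 0"
      unfolding tangential_along_def by blast
    then show ?thesis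
      using grad_from_eq[OF cl[OF x(1)]] unfolding inner_T
      by (simp add: normal_part_def inv1 inner_prod_def)
  qed
  define m where "m = deriv f s0"
  define n where "n = T (- m, 1)"
  define u where "u = G Q \<bullet> T (1, 0)"
  define k where "k = hess_map (H Q) (G Q) \<bullet> n"
  have QA: "Q \<in> closure \<Omega>m" by (rule cl[OF Q])
  have GQ: "G Q = u *\<^sub>R T (1, m)"
  proof -
    have "fst (inv T (G Q)) = u"
      unfolding u_def inner_T by (simp add: inner_prod_def)
    moreover have "snd (inv T (G Q)) = m * u"
      using tang[OF s0_in] unfolding TQ u_def m_def inner_T by (simp add: inner_prod_def)
    ultimately have "inv T (G Q) = u *\<^sub>R (1, m)"
      by (simp add: prod_eq_iff mult.commute)
    then have "G Q = T (u *\<^sub>R (1, m))" by (metis inv2)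
    then show ?thesis using linear_scale[OF lin] by metis
  qed
  have Gn: "G Q \<bullet> n = 0"
    unfolding GQ inner_scaleR_left unfolding n_def inner_T inv1 by (simp add: inner_prod_def)
  have norm_Q: "norm (G Q) = sonic_speed \<gamma> K (\<phi>m Q) (G Q)"
    using sonic_on_interface[OF Q] grad_from_eq[OF QA] by simp
  have speed_pos: "0 < speed_field \<gamma> K \<Omega>m \<phi>m Q" "0 < sonic_speed \<gamma> K (\<phi>m Q) (G Q)"
    using no_vacuum Q speed_field_eq[OF QA] by auto
  \<comment> \<open>\<open>u = 0\<close> would give \<open>G Q = 0\<close>, whereas its norm is the
    positive sonic speed.\<close>
  have u0: "u \<noteq> 0" using norm_Q speed_pos(2) GQ by auto
  have base_pos: "0 < (\<gamma> - 1) * (K - \<phi>m y - (norm (G y))\<^sup>2 / 2)" if "y \<in> \<Omega>m" for y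
    using solution_minus that \<open>\<gamma> > 1\<close> grad_eq unfolding potential_flow_solution_def by simp
  \<comment> \<open>Since \<open>G Q \<bullet> n = 0\<close>, the component of \<open>Dc\<close>
    along \<open>n\<close> is a multiple of \<open>k\<close>; up to sign it is the normal derivative
    assumed to be nonzero.\<close>
  have "k \<noteq> 0"
  proof
    assume "k = 0"
    let ?X = "grad_from \<Omega>m (speed_field \<gamma> K \<Omega>m \<phi>m) Q"
    have "?X = - ((\<gamma> - 1) / (2 * sonic_speed \<gamma> K (\<phi>m Q) (G Q))) *\<^sub>R (G Q + hess_map (H Q) (G Q))"
      by (rule grad_from_speed_field[OF QA speed_pos(1) base_pos])
    then have "?X \<bullet> n = 0"
      using Gn \<open>k = 0\<close> by (simp add: k_def inner_add_left inner_diff_left)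
    moreover have "?X \<bullet> n = - normal_part T f Q ?X"
      unfolding n_def inner_T by (simp add: normal_part_def m_def s0 inner_prod_def)
    ultimately show False
      using normal chart Q unfolding normal_derivative_nonzero_def by fastforce
  qed
  moreover have "0 \<le> k"
  proof -
    \<comment> \<open>This is \<open>|D\<phi>|\<^sup>2 - c\<^sup>2\<close> with Bernoulli's law
      inserted, using \<open>1 + (\<gamma> - 1) / 2 = (\<gamma> + 1) / 2\<close>. It contains no
      root, so \<open>g\<close> is as regular as \<open>\<phi>m\<close> and
      \<open>G\<close>.\<close>
    define g where "g x = (\<gamma> + 1) / 2 * (G x \<bullet> G x) + (\<gamma> - 1) * (\<phi>m x - K)" for x
    have g_eq: "g x = (norm (G x))\<^sup>2 - (\<gamma> - 1) * (K - \<phi>m x - (norm (G x))\<^sup>2 / 2)" for x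
      by (simp add: g_def power2_norm_eq_inner field_simps)
    have gQ: "g Q = 0"
    proof -
      have "0 < (\<gamma> - 1) * (K - \<phi>m Q - (norm (G Q))\<^sup>2 / 2)"
        using speed_pos(2) by (simp add: sonic_speed_def)
      then show ?thesis
        by (subst g_eq, subst (1) norm_Q) (simp add: sonic_speed_def)
    qed
    have g_pos: "0 < g x" if "x \<in> \<Omega>m" for x
    proof -
      have "sqrt ((\<gamma> - 1) * (K - \<phi>m x - (norm (G x))\<^sup>2 / 2)) < norm (G x)"
        using bspec[OF supersonic that] unfolding grad_eq[OF that] sonic_speed_def .
      then have "(\<gamma> - 1) * (K - \<phi>m x - (norm (G x))\<^sup>2 / 2) < (norm (G x))\<^sup>2"
        by (metis norm_ge_zero real_sqrt_less_iff real_sqrt_unique)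
      then show ?thesis by (simp add: g_eq)
    qed
    define y where "y t = Q + t *\<^sub>R n" for t
    have y: "inv T (y t) = (s0 - t * m, f s0 + t)" for t
    proof -
      have "y t = T ((s0, f s0) + t *\<^sub>R (- m, 1))"
        unfolding linear_add[OF lin] linear_scale[OF lin] by (simp add: y_def TQ n_def)
      then show ?thesis by (simp add: inv1)
    qed
    \<comment> \<open>\<open>above\<close> concerns vertical translates, but the path
      \<open>y\<close> runs along the normal. Its height over the graph has derivative
      \<open>1 + m\<^sup>2 > 0\<close> at 0, so it enters \<open>\<Omega>m\<close>.\<close>
    have "((\<lambda>t. f s0 + t - f (s0 - t * m)) has_real_derivative 1 + m * m) (at 0)"
    proof -
      have "s0 \<in> {l1<..<l2}" using s0_in sub by blast
      then have "(f has_real_derivative m) (at (s0 - 0 * m))"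
        using deriv_f by (simp add: m_def)
      moreover have "((\<lambda>t. s0 - t * m) has_real_derivative - m) (at 0)"
        by (auto intro!: derivative_eq_intros)
      ultimately have "((\<lambda>t. f (s0 - t * m)) has_real_derivative m * - m) (at 0)"
        by (rule DERIV_chain2)
      then show ?thesis
        by (auto intro!: derivative_eq_intros)
    qed
    from DERIV_pos_inc_right[OF this] obtain d1 where "d1 > 0"
      and d1: "\<And>t. 0 < t \<Longrightarrow> t < d1 \<Longrightarrow> f (s0 - t * m) < f s0 + t"
      by (force simp: add_pos_nonneg)
    \<comment> \<open>The second bound keeps \<open>y t\<close> in \<open>ball Q e\<close>, where
      \<open>near\<close> controls its coordinates; the summand 1 excludes a zero
      denominator.\<close>
    define d where "d = min d1 (e / (norm n + 1))"
    have "d > 0" using \<open>d1 > 0\<close> abe by (simp add: d_def add_nonneg_pos)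
    have y_in: "y t \<in> \<Omega>m" if t: "0 < t" "t < d" for t
    proof -
      have "t * (norm n + 1) < e"
        using t by (simp add: d_def pos_less_divide_eq add_nonneg_pos)
      then have "norm (t *\<^sub>R n) < e"
        using t by (simp add: distrib_left)
      then have "y t \<in> ball Q e"
        by (simp add: y_def dist_norm)
      from near[OF this] have 1: "s0 - t * m \<in> {s0 - a<..<s0 + a}"
        and 2: "\<bar>f s0 + t - f (s0 - t * m)\<bar> < b"
        unfolding y by auto
      have "T (s0 - t * m, f (s0 - t * m) + (f s0 + t - f (s0 - t * m))) \<in> \<Omega>m"
        by (rule above[OF 1]) (use 2 d1[of t] t in \<open>auto simp: d_def\<close>)
      moreover have "y t = T (s0 - t * m, f s0 + t)"
        using inv2[of "y t"] by (simp add: y)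
      ultimately show ?thesis by simp
    qed
    have y0: "y 0 = Q" by (simp add: y_def)
    have cont_y: "continuous_on X y" for X
      unfolding y_def by (intro continuous_intros)
    have y_cl: "y ` {0..<d} \<subseteq> closure \<Omega>m"
    proof
      fix x assume "x \<in> y ` {0..<d}"
      then obtain t where "0 \<le> t" "t < d" "x = y t" by auto
      then show "x \<in> closure \<Omega>m"
        using y_in[of t] y0 QA closure_subset by (cases "t = 0") auto
    qed
    note comp = continuous_on_compose2[OF _ cont_y y_cl]
    \<comment> \<open>The chain rule along \<open>y\<close>. At \<open>t = 0\<close> tangency
      removes the last term, and symmetry of the Hessian turns the first into
      \<open>(\<gamma> + 1) k\<close>.\<close>
    define g' where "g' t = (\<gamma> + 1) * (hess_map (H (y t)) n \<bullet> G (y t)) + (\<gamma> - 1) * (G (y t) \<bullet> n)" for t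
    have "0 \<le> g' 0"
    proof (rule one_sided_derivative_nonneg[OF \<open>d > 0\<close>])
      show "g (y 0) = 0" by (simp add: y0 gQ)
      show "0 < g (y t)" if "0 < t" "t < d" for t
        using g_pos y_in that by blast
      show "((\<lambda>t. g (y t)) has_real_derivative g' t) (at t)" if "0 < t" "t < d" for t
      proof -
        have y': "(y has_derivative (\<lambda>h. h *\<^sub>R n)) (at t)"
          unfolding y_def by (auto intro!: derivative_eq_intros)
        have "((\<lambda>t. \<phi>m (y t)) has_derivative (\<lambda>h. h * (G (y t) \<bullet> n))) (at t)"
          using has_derivative_compose[OF y' deriv[OF y_in[OF that]]] by simp
        moreover have "((\<lambda>t. G (y t)) has_derivative (\<lambda>h. h *\<^sub>R hess_map (H (y t)) n)) (at t)"
          using has_derivative_compose[OF y' deriv_G[OF y_in[OF that]]] by (simp add: hess_map_scaleR)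
        ultimately have "((\<lambda>t. g (y t)) has_derivative (\<lambda>h. g' t * h)) (at t)"
          unfolding g_def g'_def
          by (auto intro!: derivative_eq_intros simp: fun_eq_iff inner_commute field_simps)
        then show ?thesis by (simp add: has_field_derivative_def)
      qed
      show "continuous_on {0..<d} (\<lambda>t. g (y t))"
        unfolding g_def by (intro continuous_intros comp cont cont_G)
      have "continuous_on {0..<d} g'"
        unfolding g'_def by (intro continuous_intros comp cont_H cont_G)
      then have "(g' \<longlongrightarrow> g' 0) (at 0 within {0..<d})"
        using \<open>d > 0\<close> by (simp add: continuous_on_def)
      then have "(g' \<longlongrightarrow> g' 0) (at 0 within {0..d / 2})"
        by (rule tendsto_within_subset) (use \<open>d > 0\<close> in auto)
      then show "(g' \<longlongrightarrow> g' 0) (at_right 0)"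
        using \<open>d > 0\<close> by (simp add: at_within_Icc_at_right)
    qed
    then have "0 \<le> (\<gamma> + 1) * k"
      using Gn symmetric[OF QA, of n "G Q"] by (simp add: g'_def y0 k_def)
    then show ?thesis
      using \<open>\<gamma> > 1\<close> by (simp add: zero_le_mult_iff)
  qed
  ultimately have "0 < k" by simp
  \<comment> \<open>\<open>G Q\<close> is \<open>u\<close> times the tangent
    \<open>T (1, m)\<close>, so one more factor \<open>u\<close> makes the denominator a square: the
    sign is that of \<open>k\<close>, whichever way the flow runs along the curve.\<close>
  have k_eq: "hess_map (H Q) (T (1, m)) \<bullet> n / u = k / (u * u)"
    using u0 by (simp add: k_def GQ hess_map_scaleR)
  show ?thesis
  proof (rule slope_strict_mono[OF lin closure_subset abe(1,2) _ _ above _ cont_G cont_H deriv_G tang])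
    show "(f has_real_derivative deriv f s) (at s)" if "s \<in> {s0 - a<..<s0 + a}" for s
      using deriv_f sub that by blast
    show "continuous_on {s0 - a<..<s0 + a} (deriv f)"
      by (rule continuous_on_subset[OF cont_f' sub])
    show "T (s, f s) \<in> closure \<Omega>m" if "s \<in> {s0 - a<..<s0 + a}" for s
      using on[OF that] cl by blast
    show "G (T (s0, f s0)) \<bullet> T (1, 0) \<noteq> 0"
      using u0 by (simp add: TQ u_def)
    show "0 < hess_map (H (T (s0, f s0))) (T (1, deriv f s0)) \<bullet> T (- deriv f s0, 1)
        / (G (T (s0, f s0)) \<bullet> T (1, 0))"
      using k_eq \<open>0 < k\<close> u0 unfolding TQ m_def n_def u_def
      by (metis divide_pos_pos not_real_square_gt_zero)
  qed
qed

text \<open>In chart coordinates \<open>\<Omega>m\<close> is, inside a small ball, the strict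
  epigraph of a function with strictly increasing slope, and \<open>\<Gamma>\<close> is its graph.
  Both claims are then statements about segments above that graph.\<close>

lemma strictly_convex_at:
  assumes "\<gamma> > 1"
    and tangential: "tangential_along \<Gamma> (grad_from \<Omega>m \<phi>m)"
    and normal: "normal_derivative_nonzero \<Gamma> \<Omega>m (speed_field \<gamma> K \<Omega>m \<phi>m)"
    and chart: "graph_chart \<Gamma> Q T r l1 l2 f" and Q: "Q \<in> \<Gamma>"
    and s0: "s0 = fst (inv T Q)"
    and abe: "0 < a" "0 < b" "0 < e" and sub: "{s0 - a<..<s0 + a} \<subseteq> {l1<..<l2}"
    and near: "\<And>x. x \<in> ball Q e \<Longrightarrow> fst (inv T x) \<in> {s0 - a<..<s0 + a} \<and>
        \<bar>snd (inv T x) - f (fst (inv T x))\<bar> < b"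
    and on: "\<And>s. s \<in> {s0 - a<..<s0 + a} \<Longrightarrow> T (s, f s) \<in> \<Gamma> \<inter> ball Q r"
    and above: "\<And>s t. s \<in> {s0 - a<..<s0 + a} \<Longrightarrow> 0 < t \<Longrightarrow> t < b \<Longrightarrow> T (s, f s + t) \<in> \<Omega>m"
    and below: "\<And>s t. s \<in> {s0 - a<..<s0 + a} \<Longrightarrow> 0 < t \<Longrightarrow> t < b \<Longrightarrow> T (s, f s - t) \<in> \<Omega>p"
  shows "\<exists>r>0. convex (\<Omega>m \<inter> ball Q r) \<and>
    (\<forall>x\<in>\<Gamma> \<inter> ball Q r. \<forall>y\<in>\<Gamma> \<inter> ball Q r. x \<noteq> y \<longrightarrow> open_segment x y \<subseteq> \<Omega>m)"
proof -
  have T: "orthogonal_transformation T" and C11: "C11_on {l1<..<l2} f"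
    using chart by (auto simp: graph_chart_def)
  have inv1: "inv T (T z) = z" and inv2: "T (inv T z) = z" for z
    using T by (simp_all add: orthogonal_transformation_inj orthogonal_transformation_surj
        inv_f_f surj_f_inv_f)
  have lin: "linear (inv T)" and inj: "inj (inv T)"
    using orthogonal_transformation_inv[OF T]
    by (simp_all add: orthogonal_transformation_linear orthogonal_transformation_inj)
  obtain d where d: "d > 0" "d \<le> a" and mono: "strict_mono_on {s0 - d<..<s0 + d} (deriv f)"
    using slope_strict_mono_near[OF assms(1-5) s0 abe sub near on above] by blast
  have deriv_f: "(f has_real_derivative deriv f s) (at s)" if "s \<in> {s0 - d<..<s0 + d}" for s
  proof -
    have "s \<in> {s0 - a<..<s0 + a}" using that d by auto
    then have "s \<in> {l1<..<l2}" using sub by blast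
    then show ?thesis
      using C11 by (simp add: C11_on_def DERIV_deriv_iff_real_differentiable)
  qed
  \<comment> \<open>\<open>d\<close> confines the first coordinate to the interval of monotone
    slope, \<open>T\<close> being an isometry; \<open>e\<close> keeps the height below
    \<open>b\<close>.\<close>
  define \<rho> where "\<rho> = min d e"
  have \<rho>: "\<rho> > 0" using d abe by (simp add: \<rho>_def)
  have fst_near: "fst (inv T x) \<in> {s0 - d<..<s0 + d}" if "x \<in> ball Q \<rho>" for x
  proof -
    have "\<bar>fst (inv T x) - s0\<bar> \<le> norm (inv T x - inv T Q)"
      unfolding s0 by (metis fst_diff norm_fst_le prod.collapse real_norm_def)
    also have "\<dots> = dist Q x"
      using orthogonal_transformation_norm[OF orthogonal_transformation_inv[OF T]]
        linear_diff[OF lin] by (metis dist_commute dist_norm)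
    also have "\<dots> < d" using that by (simp add: \<rho>_def)
    finally show ?thesis by (auto simp: abs_less_iff)
  qed
  let ?h = "\<lambda>x. snd (inv T x) - f (fst (inv T x))"
  have x_eq: "x = T (fst (inv T x), f (fst (inv T x)) + ?h x)" for x
    by (simp add: inv2)
  have plus: "x \<in> \<Omega>m" if "x \<in> ball Q \<rho>" "?h x > 0" for x
    using above[of "fst (inv T x)" "?h x"] near[of x] that x_eq[of x] by (auto simp: \<rho>_def)
  have minus: "x \<in> \<Omega>p" if "x \<in> ball Q \<rho>" "?h x < 0" for x
    using below[of "fst (inv T x)" "- ?h x"] near[of x] that x_eq[of x] by (auto simp: \<rho>_def)
  \<comment> \<open>Points under the graph belong to \<open>\<Omega>p\<close>, hence neither to
    \<open>\<Omega>m\<close> nor to \<open>\<Gamma>\<close>.\<close>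
  have ge: "?h x \<ge> 0" if "x \<in> ball Q \<rho>" "x \<in> \<Omega>m \<union> \<Gamma>" for x
    using minus[OF that(1)] that(2) disjoint disjoint_sonic sonic_subset by force
  have segment: "open_segment x y \<subseteq> \<Omega>m \<inter> ball Q \<rho>"
    if x: "x \<in> ball Q \<rho>" "x \<in> \<Omega>m \<union> \<Gamma>" and y: "y \<in> ball Q \<rho>" "y \<in> \<Omega>m \<union> \<Gamma>" and "x \<noteq> y" for x y
  proof
    fix z assume z: "z \<in> open_segment x y"
    have zB: "z \<in> ball Q \<rho>"
      using z x(1) y(1) convex_ball convex_contains_open_segment by blast
    have "inv T z \<in> open_segment (inv T x) (inv T y)"
      using z open_segment_linear_image[OF lin inj] by blast
    moreover have "inv T x \<noteq> inv T y"
      using \<open>x \<noteq> y\<close> inj by (auto dest: injD)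
    moreover have "f (fst (inv T x)) \<le> snd (inv T x)" "f (fst (inv T y)) \<le> snd (inv T y)"
      using ge[OF x] ge[OF y] by simp_all
    ultimately have "f (fst (inv T z)) < snd (inv T z)"
      using open_segment_above_graph[OF deriv_f mono fst_near[OF x(1)] fst_near[OF y(1)]] by blast
    then show "z \<in> \<Omega>m \<inter> ball Q \<rho>"
      using plus[OF zB] zB by simp
  qed
  have "convex (\<Omega>m \<inter> ball Q \<rho>)"
    unfolding convex_contains_open_segment
  proof (intro ballI)
    fix x y assume "x \<in> \<Omega>m \<inter> ball Q \<rho>" "y \<in> \<Omega>m \<inter> ball Q \<rho>"
    then show "open_segment x y \<subseteq> \<Omega>m \<inter> ball Q \<rho>"
      using segment[of x y] by (cases "x = y") auto
  qed
  with \<rho> segment show ?thesis by blast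
qed

end

theorem theorem2p3:
  fixes \<gamma> K :: real
    and \<Lambda> \<Omega>m \<Omega>p S \<Gamma> :: "plane set"
    and \<phi>m \<phi>p :: "plane \<Rightarrow> real"
  assumes "\<gamma> > 1"
    and "sonic_configuration \<gamma> K \<Lambda> \<Omega>m \<Omega>p \<phi>m \<phi>p S \<Gamma>"
    and "connected S"
    and "tangential_along \<Gamma> (grad_from \<Omega>m \<phi>m)"
    and "normal_derivative_nonzero \<Gamma> \<Omega>m (speed_field \<gamma> K \<Omega>m \<phi>m)"
  shows "strictly_convex_viewed_from \<Omega>m \<Gamma>"
  unfolding strictly_convex_viewed_from_def
proof
  interpret sonic_configuration \<gamma> K \<Lambda> \<Omega>m \<Omega>p \<phi>m \<phi>p S \<Gamma> by (rule assms(2))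
  fix Q assume Q: "Q \<in> \<Gamma>"
  obtain T r l1 l2 f where chart: "graph_chart \<Gamma> Q T r l1 l2 f"
    using charts Q by blast
  define s0 where "s0 = fst (inv T Q)"
  obtain a b e where abe: "0 < a" "0 < b" "0 < e" "{s0 - a<..<s0 + a} \<subseteq> {l1<..<l2}"
    and near: "\<And>x. x \<in> ball Q e \<Longrightarrow> fst (inv T x) \<in> {s0 - a<..<s0 + a} \<and>
        \<bar>snd (inv T x) - f (fst (inv T x))\<bar> < b"
    and on: "\<And>s. s \<in> {s0 - a<..<s0 + a} \<Longrightarrow> T (s, f s) \<in> \<Gamma> \<inter> ball Q r"
    and sides: "(\<forall>s\<in>{s0 - a<..<s0 + a}. \<forall>t\<in>{0<..<b}. T (s, f s + t) \<in> \<Omega>m \<and> T (s, f s - t) \<in> \<Omega>p) \<or>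
     (\<forall>s\<in>{s0 - a<..<s0 + a}. \<forall>t\<in>{0<..<b}. T (s, f s + t) \<in> \<Omega>p \<and> T (s, f s - t) \<in> \<Omega>m)"
    using chart_sides[OF chart Q, folded s0_def] by blast
  from sides show "\<exists>r>0. convex (\<Omega>m \<inter> ball Q r) \<and>
    (\<forall>x\<in>\<Gamma> \<inter> ball Q r. \<forall>y\<in>\<Gamma> \<inter> ball Q r. x \<noteq> y \<longrightarrow> open_segment x y \<subseteq> \<Omega>m)"
  proof
    assume "\<forall>s\<in>{s0 - a<..<s0 + a}. \<forall>t\<in>{0<..<b}. T (s, f s + t) \<in> \<Omega>m \<and> T (s, f s - t) \<in> \<Omega>p"
    then show ?thesis
      by (intro strictly_convex_at[OF assms(1,4,5) chart Q s0_def abe near on]) auto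
  next
    assume sides': "\<forall>s\<in>{s0 - a<..<s0 + a}. \<forall>t\<in>{0<..<b}. T (s, f s + t) \<in> \<Omega>p \<and> T (s, f s - t) \<in> \<Omega>m"
    \<comment> \<open>\<open>\<Omega>m\<close> lies below the graph here; the reflected chart with
      \<open>- f\<close> puts it above, and \<open>a\<close>, \<open>b\<close>, \<open>e\<close>
      serve unchanged.\<close>
    let ?T = "\<lambda>z. T (fst z, - snd z)"
    have T: "orthogonal_transformation T"
      using chart by (simp add: graph_chart_def)
    have chart': "graph_chart \<Gamma> Q ?T r l1 l2 (\<lambda>s. - f s)"
      by (rule graph_chart_reflect[OF chart])
    then have "orthogonal_transformation ?T"
      by (simp add: graph_chart_def)
    then have inv: "inv ?T x = (fst (inv T x), - snd (inv T x))" for x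
      using T by (intro inv_f_eq)
        (simp_all add: orthogonal_transformation_inj orthogonal_transformation_surj surj_f_inv_f)
    show ?thesis
    proof (rule strictly_convex_at[OF assms(1,4,5) chart' Q _ abe])
      show "s0 = fst (inv ?T Q)" by (simp add: inv s0_def)
      show "fst (inv ?T x) \<in> {s0 - a<..<s0 + a} \<and> \<bar>snd (inv ?T x) - - f (fst (inv ?T x))\<bar> < b"
        if "x \<in> ball Q e" for x
        using near[OF that] by (simp add: inv abs_minus_commute)
      fix s assume s: "s \<in> {s0 - a<..<s0 + a}"
      show "?T (s, - f s) \<in> \<Gamma> \<inter> ball Q r"
        using on[OF s] by simp
      fix t assume "0 < t" "t < b"
      then have "T (s, f s + t) \<in> \<Omega>p" "T (s, f s - t) \<in> \<Omega>m"
        using sides' s by auto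
      then show "?T (s, - f s + t) \<in> \<Omega>m" "?T (s, - f s - t) \<in> \<Omega>p"
        by (simp_all add: add.commute)
    qed
  qed
qed

end
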